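(* Let $P \subset \mathbb{R}^d$ be a random $0/1$ polytope distributed according to any one of the following three models: (i) (balls-into-bins model) for some $n \in \mathbb{N}$, choose $S_1,\dots,S_n$ independently and uniformly at random from $\{0,1\}^d$ (repetition allowed) and let $P = \operatorname{conv}\{S_1,\dots,S_n\}$; (ii) (binomial model) for some $p \in (0,1)$, let $S \subset \{0,1\}^d$ be the random set containing each $v \in \{0,1\}^d$ independently with probability $p$, and let $P = \operatorname{conv} S$; (iii) (uniform model) for some $1 \le n \le 2^d$, let $U$ be chosen uniformly at random among all $n$-element subsets of $\{0,1\}^d$, and let $P = \operatorname{conv} U$. Then the vertex expansion of $P$ is $\Omega(1/d^{3/2})$ with high probability; that is, there is an absolute constant $C>0$ such that the vertex expansion of $P$ is at least $C d^{-3/2}$ with probability at least $f(d)$, where $f$ is a function of $d$ alone (independent of the model parameter $n$ or $p$) with $f(d) \to 1$ as $d \to \infty$.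
   Context: A $0/1$ polytope in $\mathbb{R}^d$ is the convex hull of a subset of $\{0,1\}^d$. The graph of a polytope $P$ has as vertices the vertices of $P$ and as edges the edges ($1$-dimensional faces) of $P$. For a graph $G=(V,E)$ and $S \subset V$, $N(S)$ denotes the set of vertices $v \in V \setminus S$ adjacent to some vertex of $S$. The vertex expansion of $G$ is $\min\{ |N(S)|/|S| : S \subset V,\ 1 \le |S| \le |V|/2\}$, and the vertex expansion of a polytope is the vertex expansion of its graph. *)

theory Defs
  imports "HOL-Analysis.Finite_Function_Topology" "HOL-Probability.Probability"
begin

text \<open>
  The dimension \<open>d\<close> is quantified inside the theorem (after the absolute constant and the
  probability bound), so it cannot be a type index. All the spaces \<open>\<real>\<^sup>d\<close> are realised inside the
  real vector space of finitely supported sequences, \<open>\<real>\<^sup>d\<close> being the subspace of sequences that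
  vanish at every index \<open>\<ge> d\<close>. Convex hulls, extreme points and faces of a set depend only on the
  vector space it spans, so they are those of \<open>\<real>\<^sup>d\<close>.
\<close>

definition cube :: "nat \<Rightarrow> (nat \<Rightarrow>\<^sub>0 real) set" where
  "cube d = {x. (\<forall>i<d. Poly_Mapping.lookup x i \<in> {0, 1}) \<and>
                (\<forall>i\<ge>d. Poly_Mapping.lookup x i = 0)}"

text \<open>
  The library constants \<open>aff_dim\<close> and \<open>edge_of\<close> are restricted to Euclidean spaces; the following
  two definitions are their counterparts in an arbitrary real vector space.
\<close>

definition one_dimensional :: "'a::real_vector set \<Rightarrow> bool" where
  "one_dimensional F \<longleftrightarrow>
     (\<exists>B. affine hull B = affine hull F \<and> \<not> affine_dependent B \<and> card B = 2)"

definition polytope_edge :: "'a::real_vector set \<Rightarrow> 'a set \<Rightarrow> bool" where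
  "polytope_edge e P \<longleftrightarrow> e face_of P \<and> one_dimensional e"

lemma one_dimensional_iff_aff_dim:
  fixes F :: "'a::euclidean_space set"
  shows "one_dimensional F \<longleftrightarrow> aff_dim F = 1"
proof
  assume "one_dimensional F"
  then obtain B where B: "affine hull B = affine hull F" "\<not> affine_dependent B" "card B = 2"
    unfolding one_dimensional_def by blast
  have "aff_dim F = aff_dim B"
    using B(1) by (metis aff_dim_affine_hull)
  then show "aff_dim F = 1"
    using B aff_dim_affine_independent[OF B(2)] by simp
next
  assume "aff_dim F = 1"
  moreover obtain B where "affine hull B = affine hull F" "\<not> affine_dependent B"
      "int (card B) = aff_dim F + 1"
    using aff_dim_basis_exists[of F] by auto
  ultimately show "one_dimensional F"
    unfolding one_dimensional_def by (intro exI[of _ B]) auto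
qed

lemma polytope_edge_iff_edge_of:
  fixes P :: "'a::euclidean_space set"
  shows "polytope_edge e P \<longleftrightarrow> e edge_of P"
  by (simp add: polytope_edge_def edge_of_def one_dimensional_iff_aff_dim)

definition graph_vertices :: "'a::real_vector set \<Rightarrow> 'a set" where
  "graph_vertices P = {v. v extreme_point_of P}"

text \<open>Each one-dimensional face contributes the set of its two endpoints.\<close>

definition graph_edges :: "'a::real_vector set \<Rightarrow> 'a set set" where
  "graph_edges P = {{v. v extreme_point_of e} | e. polytope_edge e P}"

definition neighbourhood :: "'v set \<Rightarrow> 'v set set \<Rightarrow> 'v set \<Rightarrow> 'v set" where
  "neighbourhood V E S = {v \<in> V - S. \<exists>u\<in>S. {u, v} \<in> E}"

text \<open>
  For a graph with at most one vertex there is no admissible set \<open>S\<close>, and the minimum over the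
  empty set is \<open>\<infinity>\<close>. For a finite graph with at least two vertices the infimum is over a finite
  nonempty set, hence a minimum.
\<close>

definition vertex_expansion :: "'v set \<Rightarrow> 'v set set \<Rightarrow> ereal" where
  "vertex_expansion V E =
     Inf {ereal (real (card (neighbourhood V E S)) / real (card S)) | S.
            S \<subseteq> V \<and> 1 \<le> card S \<and> real (card S) \<le> real (card V) / 2}"

definition polytope_expansion :: "'a::real_vector set \<Rightarrow> ereal" where
  "polytope_expansion P = vertex_expansion (graph_vertices P) (graph_edges P)"

definition balls_into_bins_polytope :: "nat \<Rightarrow> nat \<Rightarrow> (nat \<Rightarrow>\<^sub>0 real) set pmf" where
  "balls_into_bins_polytope d n =
     map_pmf (\<lambda>xs. convex hull (set xs)) (replicate_pmf n (pmf_of_set (cube d)))"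

definition binomial_polytope :: "nat \<Rightarrow> real \<Rightarrow> (nat \<Rightarrow>\<^sub>0 real) set pmf" where
  "binomial_polytope d p =
     map_pmf (\<lambda>X. convex hull {v \<in> cube d. X v}) (Pi_pmf (cube d) False (\<lambda>_. bernoulli_pmf p))"

definition uniform_polytope :: "nat \<Rightarrow> nat \<Rightarrow> (nat \<Rightarrow>\<^sub>0 real) set pmf" where
  "uniform_polytope d n =
     map_pmf (\<lambda>U. convex hull U) (pmf_of_set {U. U \<subseteq> cube d \<and> card U = n})"

text \<open>
  The sets passed to \<open>pmf_of_set\<close> and \<open>Pi_pmf\<close> above are finite and, where required, nonempty.
\<close>

lemma bij_betw_cube:
  "bij_betw (\<lambda>x. {i. Poly_Mapping.lookup x i = 1}) (cube d) (Pow {..<d})"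
proof (rule bij_betwI')
  fix x y assume x: "x \<in> cube d" and y: "y \<in> cube d"
  show "({i. Poly_Mapping.lookup x i = 1} = {i. Poly_Mapping.lookup y i = 1}) = (x = y)"
  proof
    assume eq: "{i. Poly_Mapping.lookup x i = 1} = {i. Poly_Mapping.lookup y i = 1}"
    show "x = y"
    proof (rule poly_mapping_eqI)
      fix i
      have "Poly_Mapping.lookup x i = 1 \<longleftrightarrow> Poly_Mapping.lookup y i = 1"
        using eq by blast
      then show "Poly_Mapping.lookup x i = Poly_Mapping.lookup y i"
        using x y unfolding cube_def by (cases "i < d") (force simp: not_less)+
    qed
  qed simp
next
  fix x assume "x \<in> cube d"
  then show "{i. Poly_Mapping.lookup x i = 1} \<in> Pow {..<d}"
    by (auto simp: cube_def) (metis not_less zero_neq_one)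
next
  fix A assume A: "A \<in> Pow {..<d}"
  then have fin: "finite A" by (auto intro: finite_subset)
  define x :: "nat \<Rightarrow>\<^sub>0 real" where "x = Abs_poly_mapping (\<lambda>i. if i \<in> A then 1 else 0)"
  have lx: "Poly_Mapping.lookup x i = (if i \<in> A then 1 else 0)" for i
    unfolding x_def using fin by (subst lookup_Abs_poly_mapping) auto
  show "\<exists>x\<in>cube d. A = {i. Poly_Mapping.lookup x i = 1}"
    using A by (intro bexI[of _ x]) (auto simp: lx cube_def)
qed

lemma card_cube: "card (cube d) = 2 ^ d"
  using bij_betw_same_card[OF bij_betw_cube] by (simp add: card_Pow)

lemma finite_cube: "finite (cube d)"
  using card_cube[of d] by (metis card.infinite power_not_zero zero_neq_numeral)

lemma finite_cube_subsets: "finite {U. U \<subseteq> cube d \<and> card U = n}"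
  by (rule finite_subset[of _ "Pow (cube d)"]) (auto simp: finite_cube)

lemma cube_subsets_nonempty: "n \<le> 2 ^ d \<Longrightarrow> {U. U \<subseteq> cube d \<and> card U = n} \<noteq> {}"
  using obtain_subset_with_card_n[of n "cube d"] by (auto simp: card_cube)

end

theory Submission
  imports Defs
begin

text \<open>
  Conditionally on the number of its vertices, each of the three random sets is a uniform subset of
  its size, so it suffices to treat a uniform \<open>m\<close>-subset \<open>S\<close> of the cube. Choose \<open>k\<close> such that
  \<open>m / 2^k\<close> lies between \<open>d\<close> and \<open>2d\<close>, and group the points of \<open>S\<close> by their first \<open>k\<close> coordinates.
  With high probability each of the \<open>2^k\<close> fibres is nonempty and has at most \<open>12d\<close> points. The union
  of two fibres over adjacent points of the \<open>k\<close>-cube spans a face, so by the simplex method every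
  vertex has a neighbour in every adjacent fibre, and the graph of each fibre is connected. Hence the
  vertex expansion of \<open>conv S\<close> is at least that of the \<open>k\<close>-cube, of order \<open>1 / sqrt k\<close>, divided by
  the fibre size, up to a constant.
\<close>

section \<open>Isoperimetry on the discrete cube\<close>

text \<open>The exponent 3/2 is 1 + 1/2: fibres may hold order \<open>d\<close> points, and vertex
  isoperimetry in the \<open>k\<close>-cube costs a further \<open>sqrt k\<close>, at most
  \<open>sqrt d\<close>. Fibres of bounded mean size are out of reach of the union bound: there can
  be nearly 2^d fibres, and one of mean size mu is empty with probability about exp(-mu). With mu at
  least \<open>d\<close> the bound works because e > 2.

  A set \<open>T\<close> of vertices need not be a union of fibres. Fibres cut by \<open>T\<close>
  are handled by connectivity inside them, fibres contained in \<open>T\<close> by isoperimetry. For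
  the latter, the edge-isoperimetric inequality alone would not do: a boundary vertex can absorb
  \<open>k\<close> boundary edges, so only the order 1/k would come out. Summing square roots of the
  numbers of boundary edges recovers 1/sqrt k.

  The failure bound is the same for every size of the random set. The law of the size therefore
  never enters, and neither does \<open>n\<close> or \<open>p\<close>.\<close>

definition flip :: "'a \<Rightarrow> 'a set \<Rightarrow> 'a set" where
  "flip i X = (if i \<in> X then X - {i} else insert i X)"

text \<open>Vertices of the \<open>k\<close>-cube are coded as subsets of \<open>{..<k}\<close>. For
  \<open>X\<close> in \<open>A\<close> this is Talagrand's h_A, the number of boundary edges of
  \<open>A\<close> at \<open>X\<close>.\<close>

definition exit_degree :: "nat \<Rightarrow> nat set set \<Rightarrow> nat set \<Rightarrow> nat" where
  "exit_degree k A X = card {i. i < k \<and> flip i X \<notin> A}"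

text \<open>The triangle inequality in the Euclidean plane for the vectors (f x, g x).\<close>

lemma sqrt_sum_squares_le_sum_sqrt:
  fixes f g :: "'a \<Rightarrow> real"
  shows "sqrt ((\<Sum>x\<in>A. f x)\<^sup>2 + (\<Sum>x\<in>A. g x)\<^sup>2) \<le> (\<Sum>x\<in>A. sqrt ((f x)\<^sup>2 + (g x)\<^sup>2))"
proof (induction A rule: infinite_finite_induct)
  case (insert x A)
  then show ?case
    using real_sqrt_sum_squares_triangle_ineq[of "f x" "sum f A" "g x" "sum g A"] by simp
qed auto

text \<open>The numerical part of the induction step, with n = 2^k and with \<open>a\<close>,
  \<open>b\<close> the numbers of points in the two halves. The left side is 2a(n-a) + (a-b)^2 +
  2b(n-b). The hypothesis on \<open>t\<close> bounds the last term; the others are compared after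
  squaring. There 4a(n-a) <= n^2 and (a-b)^2 <= n^2 add up to 2n^2, which equals 4 n^2 c^2 for c =
  sqrt(1/2): the origin of this constant.\<close>

lemma two_point_inequality:
  fixes a b n s t :: real
  assumes "0 \<le> b" "b \<le> a" "a \<le> n"
    and s: "a * (n - a) \<le> n * sqrt (1/2) * s" and t: "b * (n - b) \<le> n * sqrt (1/2) * t"
  shows "(a + b) * (2 * n - (a + b)) \<le> 2 * n * sqrt (1/2) * (sqrt (s\<^sup>2 + (a - b)\<^sup>2) + t)"
proof -
  define J where "J = a * (n - a)"
  define c where "c = sqrt (1/2)"
  have c: "c\<^sup>2 = 1/2" "c \<ge> 0" by (auto simp: c_def)
  have n0: "0 \<le> n" using assms(1-3) by linarith
  have J0: "J \<ge> 0" using assms by (auto simp: J_def)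
  have "4 * J = n\<^sup>2 - (n - 2 * a)\<^sup>2" by (simp add: J_def power2_eq_square algebra_simps)
  then have J4: "4 * J \<le> n\<^sup>2" by (smt (verit) zero_le_power2)
  have d: "(a - b)\<^sup>2 \<le> n\<^sup>2" using assms by (intro power_mono) auto
  have "J\<^sup>2 \<le> (n * c * s)\<^sup>2" using s J0 by (intro power_mono) (auto simp: J_def c_def)
  then have Js: "2 * J\<^sup>2 \<le> n\<^sup>2 * s\<^sup>2" using c by (simp add: power_mult_distrib)
  have "(2 * J + (a - b)\<^sup>2)\<^sup>2 = 4 * J\<^sup>2 + (4 * J + (a - b)\<^sup>2) * (a - b)\<^sup>2"
    by (simp add: power2_eq_square algebra_simps)
  also have "\<dots> \<le> 2 * (n\<^sup>2 * s\<^sup>2) + (2 * n\<^sup>2) * (a - b)\<^sup>2"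
    using Js J4 d by (intro add_mono mult_right_mono) auto
  also have "\<dots> = (2 * n * c * sqrt (s\<^sup>2 + (a - b)\<^sup>2))\<^sup>2"
    by (simp add: power_mult_distrib c(1)) (simp add: algebra_simps)
  finally have "2 * J + (a - b)\<^sup>2 \<le> 2 * n * c * sqrt (s\<^sup>2 + (a - b)\<^sup>2)"
    by (rule power2_le_imp_le) (use n0 c(2) in simp)
  moreover have "(a + b) * (2 * n - (a + b)) = 2 * J + (a - b)\<^sup>2 + 2 * (b * (n - b))"
    by (simp add: J_def power2_eq_square algebra_simps)
  ultimately show ?thesis using t by (simp add: c_def algebra_simps)
qed

lemma exit_degree_split:
  assumes "X \<subseteq> {..<k}"
  shows "exit_degree (Suc k) A X = exit_degree k {Y \<in> A. k \<notin> Y} X + (if insert k X \<in> A then 0 else 1)"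
    and "exit_degree (Suc k) A (insert k X)
      = exit_degree k {Y. Y \<subseteq> {..<k} \<and> insert k Y \<in> A} X + (if X \<in> A then 0 else 1)"
proof -
  have k: "k \<notin> X" using assms by auto
  have 1: "{i. i < Suc k \<and> flip i X \<notin> A} = {i. i < k \<and> flip i X \<notin> {Y \<in> A. k \<notin> Y}}
      \<union> (if insert k X \<in> A then {} else {k})"
    using k by (auto simp: flip_def less_Suc_eq)
  show "exit_degree (Suc k) A X = exit_degree k {Y \<in> A. k \<notin> Y} X + (if insert k X \<in> A then 0 else 1)"
    unfolding exit_degree_def by (subst 1, subst card_Un_disjoint) auto
  have *: "flip i (insert k X) = insert k (flip i X)" "flip i X \<subseteq> {..<k}" if "i < k" for i
    using that assms by (auto simp: flip_def)
  have 2: "{i. i < Suc k \<and> flip i (insert k X) \<notin> A}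
      = {i. i < k \<and> flip i X \<notin> {Y. Y \<subseteq> {..<k} \<and> insert k Y \<in> A}} \<union> (if X \<in> A then {} else {k})"
    (is "?L = ?R")
  proof (rule set_eqI)
    fix i
    show "i \<in> ?L \<longleftrightarrow> i \<in> ?R"
    proof (cases "i < k")
      case True
      then show ?thesis using *[OF True] by simp
    next
      case False
      then show ?thesis using k by (auto simp: less_Suc_eq flip_def)
    qed
  qed
  show "exit_degree (Suc k) A (insert k X)
      = exit_degree k {Y. Y \<subseteq> {..<k} \<and> insert k Y \<in> A} X + (if X \<in> A then 0 else 1)"
    unfolding exit_degree_def by (subst 2, subst card_Un_disjoint) auto
qed

text \<open>\<open>A\<close> and \<open>B\<close> are the two halves of a set in dimension k + 1. A
  point of \<open>A\<close> with no partner in \<open>B\<close> gains one boundary edge, and there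
  are at least \<open>card A - card B\<close> such points.\<close>

lemma sum_sqrt_exit_degree_ge:
  assumes "A \<subseteq> Pow {..<k}" "B \<subseteq> Pow {..<k}" "card B \<le> card A"
  shows "sqrt ((\<Sum>X\<in>A. sqrt (exit_degree k A X))\<^sup>2 + (real (card A) - real (card B))\<^sup>2)
    \<le> (\<Sum>X\<in>A. sqrt (exit_degree k A X + (if X \<in> B then 0 else 1)))"
proof -
  have fin: "finite A" "finite B" using assms(1,2) finite_subset by blast+
  have "real (card A) - real (card B) \<le> real (card (A - B))"
    using diff_card_le_card_Diff[of B A] fin by linarith
  also have "\<dots> = (\<Sum>X\<in>A. if X \<in> B then 0 else 1)"
    using fin by (simp add: sum.If_cases set_diff_eq Int_def)
  finally have "(real (card A) - real (card B))\<^sup>2 \<le> (\<Sum>X\<in>A. if X \<in> B then 0 else 1::real)\<^sup>2"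
    using assms(3) by (intro power_mono) auto
  then have "sqrt ((\<Sum>X\<in>A. sqrt (exit_degree k A X))\<^sup>2 + (real (card A) - real (card B))\<^sup>2)
     \<le> sqrt ((\<Sum>X\<in>A. sqrt (exit_degree k A X))\<^sup>2 + (\<Sum>X\<in>A. if X \<in> B then 0 else 1::real)\<^sup>2)"
    by simp
  also have "\<dots> \<le> (\<Sum>X\<in>A. sqrt ((sqrt (exit_degree k A X))\<^sup>2 + (if X \<in> B then 0 else 1)\<^sup>2))"
    by (rule sqrt_sum_squares_le_sum_sqrt)
  also have "\<dots> = (\<Sum>X\<in>A. sqrt (exit_degree k A X + (if X \<in> B then 0 else 1)))"
    by (intro sum.cong) auto
  finally show ?thesis .
qed

text \<open>
  An isoperimetric inequality of Talagrand and Bobkov, by induction on the dimension. The square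
  roots make the sum superadditive in the sense of Minkowski, which gives the order \<open>1 / sqrt k\<close>.
\<close>

lemma card_mult_compl_le_sum_sqrt_exit_degree:
  assumes "A \<subseteq> Pow {..<k}"
  shows "real (card A) * (2 ^ k - real (card A))
    \<le> 2 ^ k * sqrt (1/2) * (\<Sum>X\<in>A. sqrt (exit_degree k A X))"
  using assms
proof (induction k arbitrary: A)
  case 0
  then have "A = {} \<or> A = {{}}" by auto
  then show ?case by auto
next
  case (Suc k)
  define A0 where "A0 = {Y \<in> A. k \<notin> Y}"
  define A1 where "A1 = {Y. Y \<subseteq> {..<k} \<and> insert k Y \<in> A}"
  have sub: "A0 \<subseteq> Pow {..<k}" "A1 \<subseteq> Pow {..<k}"
    using Suc.prems by (auto simp: A0_def A1_def less_Suc_eq) (metis PowD lessThan_iff less_antisym subsetD)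
  have fin: "finite A0" "finite A1" using sub finite_subset by blast+
  have A: "A = A0 \<union> insert k ` A1"
  proof -
    have "X \<in> insert k ` A1" if "X \<in> A" "k \<in> X" for X
      using that Suc.prems by (intro image_eqI[of _ _ "X - {k}"]) (fastforce simp: A1_def insert_absorb less_Suc_eq)+
    then show ?thesis by (auto simp: A0_def A1_def)
  qed
  have disj: "A0 \<inter> insert k ` A1 = {}" by (auto simp: A0_def)
  have inj: "inj_on (insert k) A1"
    by (rule inj_onI) (use sub in \<open>metis PowD insert_ident lessThan_iff less_irrefl subsetD\<close>)
  have card: "card A = card A0 + card A1"
    unfolding A using fin disj inj by (simp add: card_Un_disjoint card_image)
  have e0: "exit_degree (Suc k) A X = exit_degree k A0 X + (if X \<in> A1 then 0 else 1)" if "X \<in> A0" for X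
    using exit_degree_split(1)[of X k A] sub that by (auto simp: A0_def A1_def)
  have e1: "exit_degree (Suc k) A (insert k X) = exit_degree k A1 X + (if X \<in> A0 then 0 else 1)"
    if "X \<in> A1" for X
    using exit_degree_split(2)[of X k A] sub that by (auto simp: A0_def A1_def)
  define s0 where "s0 = (\<Sum>X\<in>A0. sqrt (exit_degree k A0 X))"
  define s1 where "s1 = (\<Sum>X\<in>A1. sqrt (exit_degree k A1 X))"
  define t0 where "t0 = (\<Sum>X\<in>A0. sqrt (exit_degree k A0 X + (if X \<in> A1 then 0 else 1)))"
  define t1 where "t1 = (\<Sum>X\<in>A1. sqrt (exit_degree k A1 X + (if X \<in> A0 then 0 else 1)))"
  have sum: "(\<Sum>X\<in>A. sqrt (exit_degree (Suc k) A X)) = t0 + t1"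
  proof -
    have "(\<Sum>X\<in>A. sqrt (exit_degree (Suc k) A X))
      = (\<Sum>X\<in>A0. sqrt (exit_degree (Suc k) A X)) + (\<Sum>X\<in>insert k ` A1. sqrt (exit_degree (Suc k) A X))"
      using fin disj sum.union_disjoint[of A0 "insert k ` A1" "\<lambda>X. sqrt (exit_degree (Suc k) A X)"]
      by (simp flip: A)
    also have "(\<Sum>X\<in>insert k ` A1. sqrt (exit_degree (Suc k) A X)) = t1"
      unfolding t1_def using inj by (subst sum.reindex) (auto intro!: sum.cong simp: e1)
    also have "(\<Sum>X\<in>A0. sqrt (exit_degree (Suc k) A X)) = t0"
      unfolding t0_def by (auto intro!: sum.cong simp: e0)
    finally show ?thesis .
  qed
  have ge: "s0 \<le> t0" "s1 \<le> t1"
    unfolding s0_def t0_def s1_def t1_def by (intro sum_mono; simp)+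
  have IH: "real (card A0) * (2 ^ k - real (card A0)) \<le> 2 ^ k * sqrt (1/2) * s0"
      "real (card A1) * (2 ^ k - real (card A1)) \<le> 2 ^ k * sqrt (1/2) * s1"
    unfolding s0_def s1_def using Suc.IH sub by blast+
  have "card A0 \<le> card (Pow {..<k})" "card A1 \<le> card (Pow {..<k})"
    using sub by (intro card_mono; simp)+
  then have le: "real (card A0) \<le> 2 ^ k" "real (card A1) \<le> 2 ^ k"
    by (simp_all add: card_Pow)
  have pos: "0 \<le> 2 * 2 ^ k * sqrt (1/2 :: real)" by simp
  have "(real (card A0) + real (card A1)) * (2 * 2 ^ k - (real (card A0) + real (card A1)))
      \<le> 2 * 2 ^ k * sqrt (1/2) * (t0 + t1)"
  \<comment> \<open>Only the larger half is credited with the extra boundary edges; for the smaller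
    one the monotonicity \<open>ge\<close> suffices.\<close>
  proof (cases "card A1 \<le> card A0")
    case True
    have "sqrt (s0\<^sup>2 + (real (card A0) - real (card A1))\<^sup>2) \<le> t0"
      unfolding s0_def t0_def using sum_sqrt_exit_degree_ge[OF sub True] by simp
    then have "2 * 2 ^ k * sqrt (1/2) * (sqrt (s0\<^sup>2 + (real (card A0) - real (card A1))\<^sup>2) + s1)
       \<le> 2 * 2 ^ k * sqrt (1/2) * (t0 + t1)"
      using ge pos by (intro mult_left_mono) auto
    moreover have "(real (card A0) + real (card A1)) * (2 * 2 ^ k - (real (card A0) + real (card A1)))
        \<le> 2 * 2 ^ k * sqrt (1/2) * (sqrt (s0\<^sup>2 + (real (card A0) - real (card A1))\<^sup>2) + s1)"
      by (rule two_point_inequality[OF _ _ le(1) IH]) (use True in auto)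
    ultimately show ?thesis by linarith
  next
    case False
    have "sqrt (s1\<^sup>2 + (real (card A1) - real (card A0))\<^sup>2) \<le> t1"
      unfolding s1_def t1_def using sum_sqrt_exit_degree_ge[OF sub(2,1)] False by simp
    then have "2 * 2 ^ k * sqrt (1/2) * (sqrt (s1\<^sup>2 + (real (card A1) - real (card A0))\<^sup>2) + s0)
       \<le> 2 * 2 ^ k * sqrt (1/2) * (t1 + t0)"
      using ge pos by (intro mult_left_mono) auto
    moreover have "(real (card A1) + real (card A0)) * (2 * 2 ^ k - (real (card A1) + real (card A0)))
        \<le> 2 * 2 ^ k * sqrt (1/2) * (sqrt (s1\<^sup>2 + (real (card A1) - real (card A0))\<^sup>2) + s0)"
      by (rule two_point_inequality[OF _ _ le(2) IH(2,1)]) (use False in auto)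
    ultimately have "(real (card A1) + real (card A0)) * (2 * 2 ^ k - (real (card A1) + real (card A0)))
        \<le> 2 * 2 ^ k * sqrt (1/2) * (t1 + t0)"
      by linarith
    then show ?thesis by (simp only: add.commute[of "real (card A1)"] add.commute[of t1])
  qed
  then show ?case by (simp add: card sum)
qed

text \<open>Apply the preceding inequality to the complement of \<open>Z\<close>. Its points not
  adjacent to \<open>Z\<close> contribute 0 to the sum, each of the others at most
  \<open>sqrt k\<close>.\<close>

lemma card_mult_compl_le_sqrt_card_boundary:
  assumes Z: "Z \<subseteq> Pow {..<k}"
  shows "real (card Z) * real (card (Pow {..<k} - Z))
    \<le> 2 ^ k * sqrt k * real (card {X \<in> Pow {..<k} - Z. \<exists>i<k. flip i X \<in> Z})"
proof -
  define A where "A = Pow {..<k} - Z"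
  define B where "B = {X \<in> A. \<exists>i<k. flip i X \<in> Z}"
  have fin: "finite A" "finite Z" using Z finite_subset by (auto simp: A_def)
  have B: "B \<subseteq> A" "finite B" using fin by (auto simp: B_def)
  have "card A + card Z = 2 ^ k"
    using Z fin card_Diff_subset[OF fin(2) Z] card_mono[of "Pow {..<k}" Z] by (simp add: A_def card_Pow)
  then have AZ: "2 ^ k - real (card A) = real (card Z)"
    by (metis add_diff_cancel_left' of_nat_add of_nat_numeral of_nat_power)
  have "(\<Sum>X\<in>A. sqrt (exit_degree k A X)) = (\<Sum>X\<in>B. sqrt (exit_degree k A X))"
  proof (rule sum.mono_neutral_right)
    show "\<forall>X\<in>A - B. sqrt (exit_degree k A X) = 0"
    proof
      fix X assume X: "X \<in> A - B"
      have "flip i X \<in> A" if "i < k" for i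
        using X that by (auto simp: A_def B_def flip_def)
      then have "{i. i < k \<and> flip i X \<notin> A} = {}" by auto
      then show "sqrt (exit_degree k A X) = 0" by (simp only: exit_degree_def) simp
    qed
  qed (use fin B in auto)
  also have "\<dots> \<le> (\<Sum>X\<in>B. sqrt k)"
  proof (intro sum_mono)
    fix X
    have "exit_degree k A X \<le> card {..<k}" unfolding exit_degree_def by (intro card_mono) auto
    then show "sqrt (exit_degree k A X) \<le> sqrt k" by simp
  qed
  finally have S: "(\<Sum>X\<in>A. sqrt (exit_degree k A X)) \<le> sqrt k * card B" by (simp add: mult.commute)
  have "real (card A) * real (card Z) \<le> 2 ^ k * sqrt (1/2) * (\<Sum>X\<in>A. sqrt (exit_degree k A X))"
    using card_mult_compl_le_sum_sqrt_exit_degree[of A k] unfolding AZ by (auto simp: A_def)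
  also have "\<dots> \<le> 2 ^ k * 1 * (sqrt k * card B)"
    using S by (intro mult_mono) (auto intro: sum_nonneg)
  finally show ?thesis by (simp add: A_def B_def mult_ac)
qed

section \<open>Edges of polytopes spanned by vertices of the cube\<close>

abbreviation coord :: "(nat \<Rightarrow>\<^sub>0 real) \<Rightarrow> nat \<Rightarrow> real" where
  "coord \<equiv> Poly_Mapping.lookup"

lemma face_of_convex_hull_linear_min:
  fixes g :: "'a::real_vector \<Rightarrow> real"
  assumes g: "linear g" and ge: "\<And>x. x \<in> S \<Longrightarrow> c \<le> g x"
  shows "convex hull {x \<in> S. g x = c} face_of convex hull S"
proof -
  define T where "T = convex hull {x \<in> S. g x = c}"
  interpret linear g by (rule g)
  have "T \<subseteq> {x. g x = c}"
    unfolding T_def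
  proof (rule hull_minimal)
    show "convex {x. g x = c}"
      by (auto simp: convex_alt add scale) (simp add: algebra_simps)
  qed auto
  then have T: "g x = c" if "x \<in> T" for x using that by auto
  \<comment> \<open>\<open>Q\<close> is convex and contains \<open>S\<close>, hence contains the
    hull. So a point of the hull with \<open>g\<close> equal to \<open>c\<close> must lie in
    \<open>T\<close>, and no convex combination has to be written out.\<close>
  define Q where "Q = {x. c < g x} \<union> T"
  have "convex Q"
    unfolding convex_alt
  proof (intro ballI allI impI)
    fix x y and t :: real
    assume x: "x \<in> Q" and y: "y \<in> Q" and t: "0 \<le> t \<and> t \<le> 1"
    have le: "c \<le> g x" "c \<le> g y" using x y T by (fastforce simp: Q_def)+
    have eq: "g ((1 - t) *\<^sub>R x + t *\<^sub>R y) - c = (1 - t) * (g x - c) + t * (g y - c)"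
      by (simp add: add scale) (simp add: algebra_simps)
    show "(1 - t) *\<^sub>R x + t *\<^sub>R y \<in> Q"
    proof (cases "t = 0 \<or> t = 1")
      case True
      then show ?thesis using x y by auto
    next
      case False
      then have t: "0 < t" "t < 1" using t by auto
      show ?thesis
      proof (cases "x \<in> T \<and> y \<in> T")
        case True
        then have "(1 - t) *\<^sub>R x + t *\<^sub>R y \<in> T"
          using convex_convex_hull[of "{x \<in> S. g x = c}"] t unfolding T_def convex_alt by auto
        then show ?thesis by (simp add: Q_def)
      next
        case False
        then have "c < g x \<or> c < g y" using x y by (auto simp: Q_def)
        then have "0 < (1 - t) * (g x - c) + t * (g y - c)"
          using le t by (auto intro: add_pos_nonneg add_nonneg_pos)
        then show ?thesis using eq by (auto simp: Q_def)
      qed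
    qed
  qed
  moreover have "S \<subseteq> Q"
    using ge hull_subset[of "{x \<in> S. g x = c}" convex] by (force simp: Q_def T_def)
  ultimately have Q: "convex hull S \<subseteq> Q" by (rule hull_minimal[rotated])
  show ?thesis
    unfolding face_of_def T_def[symmetric]
  proof (intro conjI ballI impI)
    show "T \<subseteq> convex hull S" unfolding T_def by (rule hull_mono) auto
    show "convex T" by (simp add: T_def)
    fix a b x
    assume a: "a \<in> convex hull S" and b: "b \<in> convex hull S" and x: "x \<in> T"
      and seg: "x \<in> open_segment a b"
    obtain t where t: "0 < t" "t < 1" "x = (1 - t) *\<^sub>R a + t *\<^sub>R b"
      using seg by (auto simp: in_segment)
    have le: "c \<le> g a" "c \<le> g b" using a b Q T by (fastforce simp: Q_def)+
    have "(1 - t) * (g a - c) + t * (g b - c) = 0"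
      using T[OF x] t(3) by (simp add: add scale) (simp add: algebra_simps)
    then have "(1 - t) * (g a - c) = 0" "t * (g b - c) = 0"
      using le t by (smt (verit) mult_nonneg_nonneg)+
    then have "g a = c" "g b = c" using t by auto
    then show "a \<in> T" "b \<in> T" using a b Q by (auto simp: Q_def)
  qed
qed

lemma coord_scaleR: "coord (r *\<^sub>R x) i = r * coord x i"
  by (simp add: scaleR_poly_mapping_def)

lemma linear_coord: "linear (\<lambda>x. coord x i)"
  by (rule linearI) (auto simp: lookup_add coord_scaleR)

text \<open>On vertices of the cube this is the Hamming distance to \<open>u\<close> over the
  coordinates in \<open>I\<close>, up to an additive constant. The signs 1 - 2 u_i make it linear,
  so it exposes the face of points agreeing with \<open>u\<close> on \<open>I\<close>.\<close>

definition corner_distance :: "nat set \<Rightarrow> (nat \<Rightarrow>\<^sub>0 real) \<Rightarrow> (nat \<Rightarrow>\<^sub>0 real) \<Rightarrow> real" where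
  "corner_distance I u x = (\<Sum>i\<in>I. (1 - 2 * coord u i) * coord x i)"

lemma linear_corner_distance: "linear (corner_distance I u)"
  unfolding corner_distance_def
  by (rule linearI) (auto simp: lookup_add coord_scaleR algebra_simps sum.distrib sum_distrib_left sum_subtractf)

lemma cube_coord: "x \<in> cube d \<Longrightarrow> coord x i = 0 \<or> coord x i = 1"
  by (auto simp: cube_def) (metis insert_iff not_less singleton_iff)

lemma cube_coord_ge: "x \<in> cube d \<Longrightarrow> d \<le> i \<Longrightarrow> coord x i = 0"
  by (auto simp: cube_def)

lemma corner_distance_diff:
  assumes "u \<in> cube d" "x \<in> cube d" "finite I"
  shows "corner_distance I u x - corner_distance I u u = card {i \<in> I. coord x i \<noteq> coord u i}"
proof -
  have "corner_distance I u x - corner_distance I u u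
      = (\<Sum>i\<in>I. (1 - 2 * coord u i) * coord x i - (1 - 2 * coord u i) * coord u i)"
    by (simp add: corner_distance_def sum_subtractf)
  also have "\<dots> = (\<Sum>i\<in>I. if coord x i \<noteq> coord u i then 1 else 0)"
  proof (intro sum.cong refl)
    fix i
    show "(1 - 2 * coord u i) * coord x i - (1 - 2 * coord u i) * coord u i
        = (if coord x i \<noteq> coord u i then 1 else 0)"
      using cube_coord[OF assms(1), of i] cube_coord[OF assms(2), of i] by auto
  qed
  also have "\<dots> = card {i \<in> I. coord x i \<noteq> coord u i}"
    using assms(3) by (simp add: sum.If_cases Int_def)
  finally show ?thesis .
qed

lemma corner_distance_ge:
  assumes "u \<in> cube d" "x \<in> cube d" "finite I"
  shows "corner_distance I u u \<le> corner_distance I u x"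
    and "corner_distance I u x = corner_distance I u u \<longleftrightarrow> (\<forall>i\<in>I. coord x i = coord u i)"
proof -
  have "card {i \<in> I. coord x i \<noteq> coord u i} = 0 \<longleftrightarrow> (\<forall>i\<in>I. coord x i = coord u i)"
    using assms(3) by auto
  then show "corner_distance I u u \<le> corner_distance I u x"
    and "corner_distance I u x = corner_distance I u u \<longleftrightarrow> (\<forall>i\<in>I. coord x i = coord u i)"
    using corner_distance_diff[OF assms] by linarith+
qed

lemma cube_eqI:
  assumes "x \<in> cube d" "y \<in> cube d" "\<And>i. i < d \<Longrightarrow> coord x i = coord y i"
  shows "x = y"
  using assms by (intro poly_mapping_eqI) (metis cube_coord_ge not_less)

lemma corner_distance_less:
  assumes "u \<in> cube d" "x \<in> cube d" "x \<noteq> u"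
  shows "corner_distance {..<d} u u < corner_distance {..<d} u x"
  using corner_distance_ge[OF assms(1,2), of "{..<d}"] cube_eqI[OF assms(2,1)] assms(3)
  by fastforce

lemma extreme_points_convex_hull_cube:
  assumes S: "S \<subseteq> cube d"
  shows "{v. v extreme_point_of convex hull S} = S"
proof
  show "S \<subseteq> {v. v extreme_point_of convex hull S}"
  proof
    fix v assume v: "v \<in> S"
    let ?g = "corner_distance {..<d} v"
    have "{x \<in> S. ?g x = ?g v} = {v}"
      using v S corner_distance_less[of v d] by force
    moreover have "convex hull {x \<in> S. ?g x = ?g v} face_of convex hull S"
      using v S by (intro face_of_convex_hull_linear_min linear_corner_distance corner_distance_ge) auto
    ultimately show "v \<in> {v. v extreme_point_of convex hull S}" by (simp add: face_of_singleton)
  qed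
qed (rule extreme_points_of_convex_hull)

lemma graph_edges_convex_hull_cubeI:
  assumes S: "S \<subseteq> cube d" and "u \<in> S" "v \<in> S" "u \<noteq> v"
    and face: "convex hull {u, v} face_of convex hull S"
  shows "{u, v} \<in> graph_edges (convex hull S)"
proof -
  have "one_dimensional (convex hull {u, v})"
    unfolding one_dimensional_def
    using assms by (intro exI[of _ "{u, v}"]) (simp add: affine_hull_convex_hull affine_independent_2)
  moreover have "{x. x extreme_point_of convex hull {u, v}} = {u, v}"
    using assms by (intro extreme_points_convex_hull_cube[of _ d]) auto
  ultimately show ?thesis
    unfolding graph_edges_def polytope_edge_def using face by blast
qed

text \<open>
  The simplex method: a vertex that does not maximise a linear functional has an improving
  neighbour. A minimal face containing \<open>u\<close> and an improving point must be an edge, since a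
  functional of the form \<open>r * g - h\<close>, with \<open>g\<close> exposing \<open>u\<close>, would cut out a smaller one.
\<close>

lemma improving_edge_exists:
  fixes l :: "(nat \<Rightarrow>\<^sub>0 real) \<Rightarrow> real"
  assumes S: "S \<subseteq> cube d" and u: "u \<in> S" and l: "linear l" and w: "w \<in> S" "l u < l w"
  shows "\<exists>v\<in>S. l u < l v \<and> {u, v} \<in> graph_edges (convex hull S)"
proof -
  define good where "good F \<longleftrightarrow> F \<subseteq> S \<and> u \<in> F \<and> convex hull F face_of convex hull S \<and> (\<exists>v\<in>F. l u < l v)"
    for F
  have "good S" using u w by (auto simp: good_def face_of_refl)
  then obtain F where F: "good F" and min: "\<And>G. good G \<Longrightarrow> card F \<le> card G"
    using ex_has_least_nat[of good S card] by blast
  have FS: "F \<subseteq> S" and uF: "u \<in> F" and face: "convex hull F face_of convex hull S"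
    using F by (auto simp: good_def)
  obtain w' where w': "w' \<in> F" "l u < l w'" using F by (auto simp: good_def)
  have Fc: "F \<subseteq> cube d" using FS S by auto
  then have fin: "finite F" using finite_cube finite_subset by blast
  \<comment> \<open>Minimality of \<open>F\<close>: the minimisers of \<open>g\<close> on
    \<open>F\<close> span a face containing \<open>u\<close> and the improving point
    \<open>v\<close>, so they are all of \<open>F\<close>.\<close>
  have const: "g x = g u"
    if g: "linear g" "\<And>x. x \<in> F \<Longrightarrow> g u \<le> g x" and v: "v \<in> F" "g v = g u" "l u < l v" and x: "x \<in> F"
    for g :: "(nat \<Rightarrow>\<^sub>0 real) \<Rightarrow> real" and v x
  proof -
    have "convex hull {x \<in> F. g x = g u} face_of convex hull F"
      using g by (rule face_of_convex_hull_linear_min)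
    then have "good {x \<in> F. g x = g u}"
      using face face_of_trans v uF FS by (auto simp: good_def)
    then have "card F \<le> card {x \<in> F. g x = g u}" by (rule min)
    then have "{x \<in> F. g x = g u} = F" using fin by (intro card_seteq) auto
    then show ?thesis using x by blast
  qed
  let ?g = "corner_distance {..<d} u"
  have g: "?g u < ?g x" if "x \<in> F" "x \<noteq> u" for x
    using that corner_distance_less[of u d x] Fc uF by auto
  have ex: "\<exists>r. \<exists>v\<in>F - {u}. h v - h u = r * (?g v - ?g u) \<and>
      (\<forall>x\<in>F. h x - h u \<le> r * (?g x - ?g u)) \<and> (l u < l v \<longrightarrow> (\<forall>x\<in>F. h x - h u = r * (?g x - ?g u)))"
    if h: "linear h" for h :: "(nat \<Rightarrow>\<^sub>0 real) \<Rightarrow> real"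
  proof -
    \<comment> \<open>The slope of \<open>h\<close> against \<open>?g\<close> as seen from
      \<open>u\<close>. With r the largest slope, r * ?g - h is minimal on \<open>F\<close> at
      \<open>u\<close> and again at the maximiser \<open>v\<close>, so \<open>const\<close> applies
      to it if \<open>v\<close> improves.\<close>
    define q where "q x = (h x - h u) / (?g x - ?g u)" for x
    have "F - {u} \<noteq> {}" using w' by force
    then obtain v where "is_arg_min (\<lambda>x. - q x) (\<lambda>x. x \<in> F - {u}) v"
      using ex_is_arg_min_if_finite[of "F - {u}" "\<lambda>x. - q x"] fin by auto
    then have v: "v \<in> F - {u}" "\<And>x. x \<in> F - {u} \<Longrightarrow> q x \<le> q v"
      by (auto simp: is_arg_min_linorder)
    have eqv: "h v - h u = q v * (?g v - ?g u)" using g[of v] v by (simp add: q_def)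
    have le: "h x - h u \<le> q v * (?g x - ?g u)" if "x \<in> F" for x
    proof (cases "x = u")
      case False
      then have "q x * (?g x - ?g u) \<le> q v * (?g x - ?g u)"
        using v(2)[of x] g[of x] that by (intro mult_right_mono) auto
      then show ?thesis using g[of x] that False by (simp add: q_def)
    qed simp
    have "h x - h u = q v * (?g x - ?g u)" if "l u < l v" "x \<in> F" for x
    proof -
      define g' where "g' x = q v * ?g x - h x" for x
      have "linear g'"
        unfolding g'_def using h linear_corner_distance[of "{..<d}" u]
        by (auto simp: linear_iff algebra_simps)
      moreover have "g' u \<le> g' x" if "x \<in> F" for x
        using le[OF that] by (simp add: g'_def algebra_simps)
      moreover have "g' v = g' u" using eqv by (simp add: g'_def algebra_simps)
      ultimately have "g' x = g' u" using const[of g' v x] v that by auto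
      then show ?thesis by (simp add: g'_def algebra_simps)
    qed
    then show ?thesis using v eqv le by blast
  qed
  \<comment> \<open>For h = l the largest slope is positive because \<open>w'\<close> improves.
    Hence its maximiser improves too, and \<open>l\<close> is a positive multiple of
    \<open>?g\<close> on \<open>F\<close>, up to a constant.\<close>
  have lF: "l u < l x" if x: "x \<in> F" "x \<noteq> u" for x
  proof -
    obtain r v where r: "v \<in> F - {u}" "l v - l u = r * (?g v - ?g u)"
        "\<forall>x\<in>F. l x - l u \<le> r * (?g x - ?g u)"
        "l u < l v \<longrightarrow> (\<forall>x\<in>F. l x - l u = r * (?g x - ?g u))"
      using ex[OF l] by blast
    have "0 < r * (?g w' - ?g u)" using r(3) w' by fastforce
    then have "0 < r" using g[of w'] w' by (metis diff_gt_0_iff_gt less_irrefl zero_less_mult_pos2)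
    moreover have "0 < r * (?g v - ?g u)" using \<open>0 < r\<close> g[of v] r(1) by simp
    then have "l u < l v" using r(2) by simp
    ultimately show ?thesis using r(4) x g[of x] by (smt (verit) mult_pos_pos)
  qed
  \<comment> \<open>Every point of \<open>F - {u}\<close> improves by now, so the slope argument
    yields equality for each coordinate functional: \<open>F\<close> lies on one line through
    \<open>u\<close>.\<close>
  have proportional: "\<exists>r. \<forall>x\<in>F. coord x i - coord u i = r * (?g x - ?g u)" for i
    using ex[OF linear_coord[of i]] lF by blast
  \<comment> \<open>Such a line holds at most one further vertex of the cube: in a coordinate where
    \<open>x\<close> and \<open>w'\<close> leave \<open>u\<close>, both take the opposite value, so
    they have the same parameter on the line.\<close>
  have "x = w'" if x: "x \<in> F" "x \<noteq> u" for x
  proof -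
    have "w' \<noteq> u" using w' by auto
    then obtain i where i: "i < d" "coord w' i \<noteq> coord u i"
      using cube_eqI[of w' d u] w' uF Fc by blast
    obtain r where r: "\<forall>x\<in>F. coord x i - coord u i = r * (?g x - ?g u)" using proportional by blast
    have "r \<noteq> 0" using r w' i by fastforce
    then have "coord x i \<noteq> coord u i" using r x g[of x] by force
    then have "coord x i = coord w' i"
      using i(2) cube_coord[OF subsetD[OF Fc x(1)], of i] cube_coord[OF subsetD[OF Fc uF], of i]
        cube_coord[OF subsetD[OF Fc w'(1)], of i] by argo
    then have "r * (?g x - ?g u) = r * (?g w' - ?g u)" using r x w' by metis
    then have eq: "?g x = ?g w'" using \<open>r \<noteq> 0\<close> by simp
    show ?thesis
    proof (rule cube_eqI)
      fix j
      obtain r' where "\<forall>x\<in>F. coord x j - coord u j = r' * (?g x - ?g u)" using proportional by blast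
      then have "coord x j - coord u j = coord w' j - coord u j" using x w' eq by simp
      then show "coord x j = coord w' j" by simp
    qed (use x w' Fc in auto)
  qed
  then have "F = {u, w'}" using uF w' by auto
  then have "{u, w'} \<in> graph_edges (convex hull S)"
    using S u FS w' face by (intro graph_edges_convex_hull_cubeI) auto
  then show ?thesis using w' FS by blast
qed

text \<open>Connectivity of the graph. Start at a point of \<open>T\<close> nearest to some
  \<open>b\<close> outside \<open>T\<close>; an edge that decreases the distance to \<open>b\<close>
  must leave \<open>T\<close>.\<close>

lemma edge_between_parts_exists:
  assumes S: "S \<subseteq> cube d" and T: "T \<subseteq> S" "T \<noteq> {}" "T \<noteq> S"
  shows "\<exists>u\<in>T. \<exists>v\<in>S - T. {u, v} \<in> graph_edges (convex hull S)"
proof -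
  obtain b where b: "b \<in> S" "b \<notin> T" using T by auto
  let ?g = "corner_distance {..<d} b"
  have fin: "finite T" by (rule finite_subset[OF T(1) finite_subset[OF S finite_cube]])
  obtain u where "is_arg_min ?g (\<lambda>x. x \<in> T) u"
    using ex_is_arg_min_if_finite[OF fin T(2)] by blast
  then have u: "u \<in> T" "\<And>x. x \<in> T \<Longrightarrow> ?g u \<le> ?g x"
    by (auto simp: is_arg_min_linorder)
  have "linear (\<lambda>x. - ?g x)" using linear_corner_distance by (rule linear_compose_neg)
  moreover have "?g b < ?g u" using b u T S by (intro corner_distance_less) auto
  ultimately obtain v where "v \<in> S" "?g v < ?g u" "{u, v} \<in> graph_edges (convex hull S)"
    using improving_edge_exists[OF S, of u "\<lambda>x. - ?g x" b] u T b by auto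
  then show ?thesis using u by fastforce
qed

lemma graph_edges_face:
  assumes "F face_of P" shows "graph_edges F \<subseteq> graph_edges P"
  unfolding graph_edges_def polytope_edge_def using face_of_trans[OF _ assms] by blast

section \<open>Expansion from fibres\<close>

definition ones :: "(nat \<Rightarrow>\<^sub>0 real) \<Rightarrow> nat set" where
  "ones v = {i. coord v i = 1}"

definition fibre :: "nat \<Rightarrow> (nat \<Rightarrow>\<^sub>0 real) set \<Rightarrow> nat set \<Rightarrow> (nat \<Rightarrow>\<^sub>0 real) set" where
  "fibre k S X = {v \<in> S. ones v \<inter> {..<k} = X}"

lemma coord_eq_iff_ones:
  assumes "x \<in> cube d" "y \<in> cube d"
  shows "coord x i = coord y i \<longleftrightarrow> (i \<in> ones x \<longleftrightarrow> i \<in> ones y)"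
  using cube_coord[OF assms(1), of i] cube_coord[OF assms(2), of i] by (auto simp: ones_def)

text \<open>Agreement with \<open>v\<close> on the first \<open>k\<close> coordinates except
  \<open>i\<close> cuts out the face spanned by the two fibres. On it the distance to
  \<open>v\<close> in coordinate \<open>i\<close> takes just two values, one per fibre, so an
  improving edge from \<open>v\<close> crosses over.\<close>

lemma cross_edge_exists:
  assumes S: "S \<subseteq> cube d" and v: "v \<in> fibre k S X" and i: "i < k" and ne: "fibre k S (flip i X) \<noteq> {}"
  shows "\<exists>w\<in>fibre k S (flip i X). {v, w} \<in> graph_edges (convex hull S)"
proof -
  let ?I = "{..<k} - {i}"
  have vS: "v \<in> S" "v \<in> cube d" and X: "ones v \<inter> {..<k} = X" using v S by (auto simp: fibre_def)
  define F where "F = {x \<in> S. corner_distance ?I v x = corner_distance ?I v v}"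
  have FS: "F \<subseteq> S" by (auto simp: F_def)
  have F: "x \<in> F \<longleftrightarrow> x \<in> S \<and> (\<forall>j\<in>?I. j \<in> ones x \<longleftrightarrow> j \<in> ones v)" for x
    using S vS coord_eq_iff_ones[of x d v] corner_distance_ge(2)[of v d x ?I]
    by (auto simp: F_def)
  have face: "convex hull F face_of convex hull S"
    unfolding F_def using S vS
    by (intro face_of_convex_hull_linear_min linear_corner_distance corner_distance_ge(1)) auto
  obtain w0 where w0: "w0 \<in> S" "ones w0 \<inter> {..<k} = flip i X" using ne by (auto simp: fibre_def)
  have mem: "j \<in> ones w0 \<longleftrightarrow> j \<in> flip i X" "j \<in> ones v \<longleftrightarrow> j \<in> X" if "j < k" for j
    using w0(2) X that by blast+
  have w0F: "w0 \<in> F" using mem w0(1) by (auto simp: F flip_def)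
  let ?l = "corner_distance {i} v"
  have l: "?l v < ?l x \<longleftrightarrow> (i \<in> ones x \<longleftrightarrow> i \<notin> ones v)" if "x \<in> S" for x
    using corner_distance_ge[of v d x "{i}"] coord_eq_iff_ones[of x d v i] S vS that by fastforce
  have "?l v < ?l w0" using l[OF w0(1)] mem[OF i] by (auto simp: flip_def)
  moreover have "v \<in> F" by (simp add: F vS)
  ultimately obtain w where w: "w \<in> F" "?l v < ?l w" "{v, w} \<in> graph_edges (convex hull F)"
    using improving_edge_exists[OF _ _ linear_corner_distance w0F] FS S by blast
  have wS: "w \<in> S" using w FS by blast
  have "ones w \<inter> {..<k} = flip i X"
  proof (rule set_eqI)
    fix j
    show "j \<in> ones w \<inter> {..<k} \<longleftrightarrow> j \<in> flip i X"
    proof (cases "j = i")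
      case True
      then show ?thesis using l[OF wS] w(2) i mem(2)[OF i] by (auto simp: flip_def)
    next
      case False
      then show ?thesis using w(1) X by (auto simp: F flip_def)
    qed
  qed
  then have "w \<in> fibre k S (flip i X)" using wS by (simp add: fibre_def)
  moreover have "{v, w} \<in> graph_edges (convex hull S)"
    using w(3) graph_edges_face[OF face] by blast
  ultimately show ?thesis by blast
qed

text \<open>A fibre spans a face, so connectivity can be applied to the graph of the fibre
  alone.\<close>

lemma inner_edge_exists:
  assumes S: "S \<subseteq> cube d" and T: "fibre k S X \<inter> T \<noteq> {}" "\<not> fibre k S X \<subseteq> T"
  shows "\<exists>u\<in>fibre k S X \<inter> T. \<exists>v\<in>fibre k S X - T. {u, v} \<in> graph_edges (convex hull S)"
proof -
  obtain v where vX: "v \<in> S" "v \<in> cube d" "ones v \<inter> {..<k} = X" using T S by (auto simp: fibre_def)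
  have "x \<in> {x \<in> S. corner_distance {..<k} v x = corner_distance {..<k} v v} \<longleftrightarrow> x \<in> fibre k S X" for x
    using S vX coord_eq_iff_ones[of x d v] corner_distance_ge(2)[of v d x "{..<k}"]
    by (auto simp: fibre_def)
  then have eq: "{x \<in> S. corner_distance {..<k} v x = corner_distance {..<k} v v} = fibre k S X"
    by blast
  have "convex hull {x \<in> S. corner_distance {..<k} v x = corner_distance {..<k} v v} face_of convex hull S"
    using S vX by (intro face_of_convex_hull_linear_min linear_corner_distance corner_distance_ge(1)) auto
  then have "graph_edges (convex hull fibre k S X) \<subseteq> graph_edges (convex hull S)"
    unfolding eq by (rule graph_edges_face)
  moreover have "fibre k S X \<subseteq> cube d" using S by (auto simp: fibre_def)
  then have "\<exists>u\<in>fibre k S X \<inter> T. \<exists>v\<in>fibre k S X - fibre k S X \<inter> T.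
      {u, v} \<in> graph_edges (convex hull fibre k S X)"
    using T by (intro edge_between_parts_exists[of _ d]) auto
  ultimately show ?thesis by blast
qed

lemma card_le_sum_fibres:
  assumes "finite S" "R \<subseteq> S" "finite I" "\<And>v. v \<in> R \<Longrightarrow> ones v \<inter> {..<k} \<in> I"
    and "\<And>X. X \<in> I \<Longrightarrow> real (card (fibre k S X)) \<le> M"
  shows "real (card R) \<le> M * real (card I)"
proof -
  have "R \<subseteq> (\<Union>X\<in>I. fibre k S X)" using assms(2,4) by (auto simp: fibre_def)
  then have "card R \<le> card (\<Union>X\<in>I. fibre k S X)"
    using assms(1,3) by (intro card_mono) (auto simp: fibre_def)
  also have "\<dots> \<le> (\<Sum>X\<in>I. card (fibre k S X))" by (rule card_UN_le[OF assms(3)])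
  finally have "real (card R) \<le> real (\<Sum>X\<in>I. card (fibre k S X))" by (rule of_nat_mono)
  also have "\<dots> = (\<Sum>X\<in>I. real (card (fibre k S X)))" by simp
  also have "\<dots> \<le> of_nat (card I) * M" using assms(5) by (rule sum_bounded_above)
  finally show ?thesis by (simp add: mult.commute)
qed

text \<open>
  Let \<open>Z\<close> be the set of fibres contained in \<open>T\<close>. Every fibre that \<open>T\<close> meets without containing it,
  and every fibre outside \<open>Z\<close> next to a fibre in \<open>Z\<close>, contains a neighbour of \<open>T\<close>.
\<close>

lemma card_le_card_neighbourhood:
  fixes M K :: real
  assumes S: "S \<subseteq> cube d" and d: "0 < d" and k: "k \<le> d"
    and ne: "\<And>X. X \<subseteq> {..<k} \<Longrightarrow> fibre k S X \<noteq> {}"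
    and M: "\<And>X. X \<subseteq> {..<k} \<Longrightarrow> real (card (fibre k S X)) \<le> M"
    and K: "M * 2 ^ k \<le> K * real (card S)"
    and T: "T \<subseteq> S" "2 * card T \<le> card S"
  shows "real (card T)
    \<le> 4 * K * M * sqrt d * real (card (neighbourhood S (graph_edges (convex hull S)) T))"
proof -
  define N where "N = neighbourhood S (graph_edges (convex hull S)) T"
  have N: "v \<in> N" if "v \<in> S - T" "u \<in> T" "{u, v} \<in> graph_edges (convex hull S)" for u v
    using that by (auto simp: N_def neighbourhood_def)
  have fS: "finite S" using S finite_cube finite_subset by blast
  have fN: "finite N" using fS by (auto simp: N_def neighbourhood_def)
  define tr where "tr v = ones v \<inter> {..<k}" for v
  have trP: "tr v \<in> Pow {..<k}" for v by (auto simp: tr_def)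
  have trN: "card (tr ` N) \<le> card N" using fN by (rule card_image_le)
  define Z where "Z = {X \<in> Pow {..<k}. fibre k S X \<subseteq> T}"
  define Y where "Y = tr ` T - Z"
  define q where "q = real (card (Pow {..<k} - Z))"
  have fin: "finite Z" "finite (tr ` T)" "finite Y"
    using fS T finite_subset by (auto simp: Z_def Y_def)
  have "{} \<subseteq> {..<k}" by simp
  then have "0 < card (fibre k S {})" using ne fS by (auto simp: card_gt_0_iff fibre_def)
  then have Mpos: "0 < M" using M[of "{}"] by simp
  have cT: "real (card T) \<le> M * real (card (tr ` T))"
    by (rule card_le_sum_fibres[OF fS T(1) fin(2), of k]) (use M trP in \<open>auto simp: tr_def\<close>)
  have cS: "real (card (S - T)) \<le> M * q"
    unfolding q_def
  proof (rule card_le_sum_fibres[OF fS, of _ _ k])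
    show "ones v \<inter> {..<k} \<in> Pow {..<k} - Z" if "v \<in> S - T" for v
      using that by (auto simp: Z_def fibre_def)
  qed (use M in auto)
  have "card (S - T) = card S - card T"
    using T fS finite_subset by (intro card_Diff_subset) auto
  then have "real (card S) \<le> 2 * real (card (S - T))" using T(2) by linarith
  also have "\<dots> \<le> 2 * (M * q)" using cS by simp
  finally have cS2: "real (card S) \<le> 2 * (M * q)" .
  have Kpos: "0 < K"
    using K Mpos by (smt (verit) mult_nonneg_nonneg mult_nonpos_nonneg of_nat_0_le_iff zero_less_power mult_pos_pos)
  \<comment> \<open>By \<open>K\<close>, \<open>M\<close> is at most \<open>K\<close> times the mean
    fibre size. Since at least half of \<open>S\<close> lies outside \<open>T\<close>, at least 2^k
    / (2K) fibres are not contained in \<open>T\<close>: the complement of \<open>Z\<close> is large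
    enough for isoperimetry.\<close>
  have "M * 2 ^ k \<le> K * (2 * (M * q))"
    using K cS2 Kpos by (smt (verit) mult_left_mono)
  then have "M * 2 ^ k \<le> M * (2 * K * q)" by (simp add: algebra_simps)
  then have Kq: "2 ^ k \<le> 2 * K * q" using Mpos by simp
  have "card (Pow {..<k} - Z) \<le> card (Pow {..<k})" by (intro card_mono) auto
  then have q: "q \<le> 2 ^ k" by (simp add: q_def card_Pow)
  have "2 ^ k \<le> 2 * K * 2 ^ k" using Kq q Kpos by (smt (verit) mult_left_mono)
  then have K1: "1 \<le> 2 * K" by simp
  have sd: "1 \<le> sqrt d" using d by simp
  show ?thesis
    unfolding N_def[symmetric]
  \<comment> \<open>If at least half of the fibres met by \<open>T\<close> are cut by it, one
    neighbour in each of these already gives |T| <= 2 M |N|.\<close>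
  proof (cases "card (tr ` T) \<le> 2 * card Y")
    case True
    have "Y \<subseteq> tr ` N"
    proof
      fix X assume X: "X \<in> Y"
      then obtain u where u: "u \<in> T" "X = tr u" "X \<notin> Z" by (auto simp: Y_def)
      have "u \<in> fibre k S X \<inter> T" using u T by (auto simp: fibre_def tr_def)
      moreover have "\<not> fibre k S X \<subseteq> T" using u trP[of u] by (auto simp: Z_def)
      ultimately obtain a b where ab: "a \<in> T" "b \<in> fibre k S X - T" "{a, b} \<in> graph_edges (convex hull S)"
        using inner_edge_exists[OF S, of k X T] by blast
      then have "b \<in> N" by (intro N) (auto simp: fibre_def)
      moreover have "tr b = X" using ab by (auto simp: fibre_def tr_def)
      ultimately show "X \<in> tr ` N" by blast
    qed
    then have "card Y \<le> card N" using trN fN card_mono[of "tr ` N" Y] by simp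
    then have "real (card (tr ` T)) \<le> 2 * real (card N)" using True by linarith
    then have "M * real (card (tr ` T)) \<le> M * (2 * real (card N))" using Mpos by simp
    also have "\<dots> = 2 * 1 * M * 1 * real (card N)" by simp
    also have "\<dots> \<le> 2 * (2 * K) * M * sqrt d * real (card N)"
      using Mpos K1 sd by (intro mult_mono) auto
    finally show "real (card T) \<le> 4 * K * M * sqrt d * real (card N)" using cT by simp
  next
    case False
    have "{X \<in> Pow {..<k} - Z. \<exists>i<k. flip i X \<in> Z} \<subseteq> tr ` N"
    proof
      fix X assume "X \<in> {X \<in> Pow {..<k} - Z. \<exists>i<k. flip i X \<in> Z}"
      then obtain i where X: "X \<in> Pow {..<k}" "X \<notin> Z" "i < k" "flip i X \<in> Z" by auto
      then obtain v where v: "v \<in> fibre k S X" "v \<notin> T" by (auto simp: Z_def)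
      have "flip i X \<subseteq> {..<k}" using X by (auto simp: Z_def)
      \<comment> \<open>The edge starts at the vertex \<open>v\<close> outside \<open>T\<close>:
        whichever point of the adjacent full fibre it reaches lies in \<open>T\<close>.\<close>
      then obtain w where w: "w \<in> fibre k S (flip i X)" "{v, w} \<in> graph_edges (convex hull S)"
        using cross_edge_exists[OF S v(1) X(3)] ne by blast
      have "w \<in> T" using w X by (auto simp: Z_def)
      then have "v \<in> N" using w v by (intro N[of v w]) (auto simp: fibre_def insert_commute)
      moreover have "tr v = X" using v by (auto simp: fibre_def tr_def)
      ultimately show "X \<in> tr ` N" by blast
    qed
    then have bN: "card {X \<in> Pow {..<k} - Z. \<exists>i<k. flip i X \<in> Z} \<le> card N"
      using trN fN card_mono[of "tr ` N"] by (meson finite_imageI le_trans)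
    have "real (card Z) * q \<le> 2 ^ k * sqrt k * real (card {X \<in> Pow {..<k} - Z. \<exists>i<k. flip i X \<in> Z})"
      unfolding q_def by (rule card_mult_compl_le_sqrt_card_boundary) (auto simp: Z_def)
    also have "\<dots> \<le> 2 ^ k * sqrt d * real (card N)"
      using bN k by (intro mult_mono) auto
    finally have le: "2 * K * (real (card Z) * q) \<le> 2 * K * (2 ^ k * sqrt d * real (card N))"
      using Kpos by simp
    have "2 ^ k * real (card Z) \<le> 2 * K * q * real (card Z)"
      using Kq by (intro mult_right_mono) auto
    also have "\<dots> = 2 * K * (real (card Z) * q)" by simp
    also note le
    also have "2 * K * (2 ^ k * sqrt d * real (card N)) = 2 ^ k * (2 * K * sqrt d * real (card N))"
      by simp
    finally have "2 ^ k * real (card Z) \<le> 2 ^ k * (2 * K * sqrt d * real (card N))" .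
    then have cZ: "real (card Z) \<le> 2 * K * sqrt d * real (card N)" by simp
    have "tr ` T \<subseteq> Z \<union> Y" by (auto simp: Y_def)
    then have "card (tr ` T) \<le> card Z + card Y"
      using fin card_mono[of "Z \<union> Y" "tr ` T"] card_Un_le[of Z Y] by simp
    then have "real (card (tr ` T)) \<le> 2 * real (card Z)" using False by linarith
    also have "\<dots> \<le> 2 * (2 * K * sqrt d * real (card N))" by (intro mult_left_mono cZ) simp
    finally have "M * real (card (tr ` T)) \<le> M * (2 * (2 * K * sqrt d * real (card N)))"
      using Mpos by simp
    then show "real (card T) \<le> 4 * K * M * sqrt d * real (card N)"
      using cT by (simp add: algebra_simps)
  qed
qed

section \<open>From neighbour counts to the expansion of the polytope\<close>

lemma polytope_expansion_geI:
  assumes S: "S \<subseteq> cube d"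
    and le: "\<And>T. T \<subseteq> S \<Longrightarrow> 2 * card T \<le> card S \<Longrightarrow>
      c * real (card T) \<le> real (card (neighbourhood S (graph_edges (convex hull S)) T))"
  shows "ereal c \<le> polytope_expansion (convex hull S)"
  unfolding polytope_expansion_def vertex_expansion_def graph_vertices_def
    extreme_points_convex_hull_cube[OF S]
proof (rule Inf_greatest, clarify)
  fix T assume T: "T \<subseteq> S" "1 \<le> card T" "real (card T) \<le> real (card S) / 2"
  then have "2 * card T \<le> card S" by linarith
  then have "c \<le> real (card (neighbourhood S (graph_edges (convex hull S)) T)) / real (card T)"
    using le[OF T(1)] T(2) by (simp add: field_simps)
  then show "ereal c \<le> ereal (real (card (neighbourhood S (graph_edges (convex hull S)) T)) / real (card T))"
    by simp
qed

text \<open>576 = 4 * 12 * 12: fibres have at most 12d points, which is at most K = 12 times the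
  mean size.\<close>

lemma polytope_expansion_ge_of_fibres:
  assumes S: "S \<subseteq> cube d" and d: "0 < d"
    and fibres: "card S \<le> 12 * d \<or> (\<exists>k\<le>d. d * 2 ^ k \<le> card S \<and>
      (\<forall>X\<subseteq>{..<k}. fibre k S X \<noteq> {} \<and> card (fibre k S X) \<le> 12 * d))"
  shows "ereal (1/576 * real d powr (-3/2)) \<le> polytope_expansion (convex hull S)"
proof (rule polytope_expansion_geI[OF S])
  fix T assume T: "T \<subseteq> S" "2 * card T \<le> card S"
  define n where "n = real (card (neighbourhood S (graph_edges (convex hull S)) T))"
  have "real d powr (3/2) = real d powr 1 * real d powr (1/2)"
    by (subst powr_add[symmetric]) simp
  then have p: "real d powr (3/2) = d * sqrt d" by (simp add: powr_half_sqrt)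
  have "real (card T) \<le> 576 * (d * sqrt d) * n"
  proof (cases "card S \<le> 12 * d")
    case True
    show ?thesis
    proof (cases "S = {}")
      case False
      \<comment> \<open>With k = 0 the only fibre is \<open>S\<close> itself, so K = 1 and M =
        \<open>card S\<close>; connectivity is all that is used.\<close>
      have "real (card T) \<le> 4 * 1 * real (card S) * sqrt d * n"
        unfolding n_def
        by (rule card_le_card_neighbourhood[OF S d, of 0]) (use T False in \<open>auto simp: fibre_def\<close>)
      also have "\<dots> \<le> 4 * 1 * (12 * real d) * sqrt d * n"
        using True by (intro mult_right_mono mult_left_mono) (auto simp: n_def)
      also have "\<dots> \<le> 576 * (d * sqrt d) * n"
        by (simp add: n_def mult_right_mono)
      finally show ?thesis .
    qed (use T in \<open>auto simp: n_def\<close>)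
  next
    case False
    then obtain k where k: "k \<le> d" "d * 2 ^ k \<le> card S"
      "\<And>X. X \<subseteq> {..<k} \<Longrightarrow> fibre k S X \<noteq> {} \<and> card (fibre k S X) \<le> 12 * d"
      using fibres by blast
    have "real (d * 2 ^ k) \<le> real (card S)" using k(2) by (rule of_nat_mono)
    then have "12 * real d * 2 ^ k \<le> 12 * real (card S)" by simp
    moreover have "real (card (fibre k S X)) \<le> 12 * real d" if "X \<subseteq> {..<k}" for X
      using k(3)[OF that] by linarith
    ultimately have "real (card T) \<le> 4 * 12 * (12 * real d) * sqrt d * n"
      unfolding n_def using k(3) T by (intro card_le_card_neighbourhood[OF S d k(1)]) auto
    then show ?thesis by (simp add: mult.assoc)
  qed
  moreover have "0 < d * sqrt d" using d by simp
  moreover have "real d powr (-3/2) = 1 / (d * sqrt d)"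
    using powr_minus_divide[of "real d" "3/2"] unfolding p by (simp only: minus_divide_left)
  ultimately show "1/576 * real d powr (-3/2) * real (card T)
      \<le> real (card (neighbourhood S (graph_edges (convex hull S)) T))"
    unfolding n_def[symmetric] by (simp add: field_simps)
qed

section \<open>Fibres of a uniform subset\<close>

text \<open>Sampling without replacement is no likelier to stay in a set of \<open>a\<close> points
  out of \<open>N\<close> than sampling with replacement: each factor (a-i)/(N-i) is at most
  a/N.\<close>

lemma binomial_mult_power_le:
  assumes "a \<le> N"
  shows "(a choose m) * N ^ m \<le> (N choose m) * a ^ m"
proof (induction m)
  case (Suc m)
  have absorb: "Suc m * (n choose Suc m) = (n - m) * (n choose m)" for n
    by (metis binomial_absorb_comp binomial_absorption)
  have le: "(a - m) * N \<le> (N - m) * a"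
    using assms by (simp add: diff_mult_distrib) (simp add: mult.commute diff_le_mono2)
  have "Suc m * ((a choose Suc m) * N ^ Suc m) = ((a choose m) * N ^ m) * ((a - m) * N)"
    using absorb[of a] by (metis mult.assoc mult.commute power_Suc)
  also have "\<dots> \<le> ((N choose m) * a ^ m) * ((N - m) * a)"
    using Suc.IH le by (rule mult_le_mono)
  also have "\<dots> = Suc m * ((N choose Suc m) * a ^ Suc m)"
    using absorb[of N] by (metis mult.assoc mult.commute power_Suc)
  finally show ?case by (simp only: mult_le_cancel1)
qed simp

lemma card_subsets_disjoint_le:
  assumes V: "finite V" "V \<noteq> {}" and F: "F \<subseteq> V"
  shows "real (card {U. U \<subseteq> V \<and> card U = m \<and> U \<inter> F = {}})
    \<le> real (card V choose m) * (1 - card F / card V) ^ m"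
proof -
  have fF: "finite F" using V F finite_subset by blast
  have N: "0 < card V" using V by (simp add: card_gt_0_iff)
  have le: "card F \<le> card V" using V F by (intro card_mono)
  have "{U. U \<subseteq> V \<and> card U = m \<and> U \<inter> F = {}} = {U. U \<subseteq> V - F \<and> card U = m}" by auto
  also have "card \<dots> = (card V - card F) choose m"
    using V F fF by (simp add: n_subsets card_Diff_subset)
  finally have c: "card {U. U \<subseteq> V \<and> card U = m \<and> U \<inter> F = {}} = (card V - card F) choose m" .
  have "real (((card V - card F) choose m) * card V ^ m) \<le> real ((card V choose m) * (card V - card F) ^ m)"
    by (intro of_nat_mono binomial_mult_power_le) simp
  then have "real ((card V - card F) choose m) \<le> real (card V choose m) * ((real (card V) - card F) ^ m / card V ^ m)"
    using N le by (simp add: field_simps of_nat_diff)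
  also have "(real (card V) - card F) ^ m / card V ^ m = (1 - card F / card V) ^ m"
    using N by (simp add: power_divide[symmetric] diff_divide_distrib)
  finally show ?thesis by (simp add: c)
qed

lemma card_supersets:
  assumes V: "finite V" and W: "W \<subseteq> V" "card W \<le> m"
  shows "card {U. U \<subseteq> V \<and> card U = m \<and> W \<subseteq> U} = (card V - card W) choose (m - card W)"
proof -
  have fW: "finite W" using V W finite_subset by blast
  have "bij_betw (\<lambda>U. U - W) {U. U \<subseteq> V \<and> card U = m \<and> W \<subseteq> U} {U. U \<subseteq> V - W \<and> card U = m - card W}"
  proof (rule bij_betw_byWitness[where f' = "\<lambda>U. U \<union> W"])
    show "(\<lambda>U. U - W) ` {U. U \<subseteq> V \<and> card U = m \<and> W \<subseteq> U} \<subseteq> {U. U \<subseteq> V - W \<and> card U = m - card W}"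
      using fW by (auto simp: card_Diff_subset)
    show "(\<lambda>U. U \<union> W) ` {U. U \<subseteq> V - W \<and> card U = m - card W} \<subseteq> {U. U \<subseteq> V \<and> card U = m \<and> W \<subseteq> U}"
    proof clarify
      fix U assume U: "U \<subseteq> V - W" "card U = m - card W"
      then have "finite U" "U \<inter> W = {}" using V finite_subset[of U V] by auto
      then have "card (U \<union> W) = m" using U W fW by (simp add: card_Un_disjoint)
      then show "U \<union> W \<subseteq> V \<and> card (U \<union> W) = m \<and> W \<subseteq> U \<union> W" using U W by auto
    qed
  qed auto
  then have "card {U. U \<subseteq> V \<and> card U = m \<and> W \<subseteq> U} = card {U. U \<subseteq> V - W \<and> card U = m - card W}"
    by (rule bij_betw_same_card)
  also have "\<dots> = (card V - card W) choose (m - card W)"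
    using V W fW by (simp add: n_subsets card_Diff_subset)
  finally show ?thesis .
qed

text \<open>Union bound over the \<open>t\<close>-subsets \<open>W\<close> of \<open>F\<close>, of
  which there are at most |F|^t / t!. Each lies in a random \<open>m\<close>-subset with probability
  (m choose t)/(N choose t), at most (m/N)^t.\<close>

lemma card_subsets_meeting_le:
  assumes V: "finite V" "V \<noteq> {}" and F: "F \<subseteq> V" and t: "t \<le> m" and m: "m \<le> card V"
  shows "real (card {U. U \<subseteq> V \<and> card U = m \<and> t \<le> card (U \<inter> F)})
    \<le> real (card V choose m) * ((card F * m / card V) ^ t / fact t)"
proof -
  have fF: "finite F" using V F finite_subset by blast
  define N where "N = card V"
  have N: "0 < N" using V by (simp add: card_gt_0_iff N_def)
  define WW where "WW = {W. W \<subseteq> F \<and> card W = t}"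
  have fW: "finite WW" using fF by (auto simp: WW_def)
  have "{U. U \<subseteq> V \<and> card U = m \<and> t \<le> card (U \<inter> F)} \<subseteq> (\<Union>W\<in>WW. {U. U \<subseteq> V \<and> card U = m \<and> W \<subseteq> U})"
  proof clarify
    fix U assume U: "U \<subseteq> V" "t \<le> card (U \<inter> F)"
    obtain W where "W \<subseteq> U \<inter> F" "card W = t" using obtain_subset_with_card_n[OF U(2)] by blast
    then show "U \<in> (\<Union>W\<in>WW. {U'. U' \<subseteq> V \<and> card U' = card U \<and> W \<subseteq> U'})" using U by (auto simp: WW_def)
  qed
  then have "card {U. U \<subseteq> V \<and> card U = m \<and> t \<le> card (U \<inter> F)}
      \<le> card (\<Union>W\<in>WW. {U. U \<subseteq> V \<and> card U = m \<and> W \<subseteq> U})"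
    by (rule card_mono[rotated]) (use fW V in auto)
  also have "\<dots> \<le> (\<Sum>W\<in>WW. card {U. U \<subseteq> V \<and> card U = m \<and> W \<subseteq> U})" by (rule card_UN_le[OF fW])
  also have "\<dots> = (\<Sum>W\<in>WW. (N - t) choose (m - t))"
    using V F t by (intro sum.cong refl) (subst card_supersets, auto simp: WW_def N_def)
  also have "\<dots> = (card F choose t) * ((N - t) choose (m - t))"
    using fF by (simp add: WW_def n_subsets)
  finally have c: "card {U. U \<subseteq> V \<and> card U = m \<and> t \<le> card (U \<inter> F)}
    \<le> (card F choose t) * ((N - t) choose (m - t))" .
  have "(N choose t) * (((N - t) choose (m - t)) * N ^ t) = (N choose m) * ((m choose t) * N ^ t)"
    using choose_mult[OF t, of N] m by (simp add: N_def)
  also have "\<dots> \<le> (N choose m) * ((N choose t) * m ^ t)"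
    using m by (intro mult_le_mono2 binomial_mult_power_le) (simp add: N_def)
  also have "\<dots> = (N choose t) * ((N choose m) * m ^ t)" by simp
  finally have "((N - t) choose (m - t)) * N ^ t \<le> (N choose m) * m ^ t"
    using t m by (simp add: N_def)
  with binomial_fact_pow have "((card F choose t) * fact t) * (((N - t) choose (m - t)) * N ^ t)
      \<le> card F ^ t * ((N choose m) * m ^ t)"
    by (rule mult_le_mono)
  then have "(card F choose t) * ((N - t) choose (m - t)) * (fact t * N ^ t)
      \<le> (N choose m) * (card F * m) ^ t"
    by (simp add: mult_ac power_mult_distrib)
  then have "card {U. U \<subseteq> V \<and> card U = m \<and> t \<le> card (U \<inter> F)} * (fact t * N ^ t) \<le> (N choose m) * (card F * m) ^ t"
    using mult_le_mono1[OF c, of "fact t * N ^ t"] by linarith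
  then have "real (card {U. U \<subseteq> V \<and> card U = m \<and> t \<le> card (U \<inter> F)} * (fact t * N ^ t))
      \<le> real ((N choose m) * (card F * m) ^ t)"
    by (rule of_nat_mono)
  then have "real (card {U. U \<subseteq> V \<and> card U = m \<and> t \<le> card (U \<inter> F)})
      \<le> real (N choose m) * ((real (card F) * m) ^ t / (fact t * real N ^ t))"
    using N by (simp add: field_simps)
  then show ?thesis by (simp add: N_def power_divide mult.commute)
qed

text \<open>n^n / n! is a single term of the series of exp n, and e <= 3.\<close>

lemma power_le_3_power_mult_fact: "real n ^ n \<le> 3 ^ n * fact n"
proof -
  have "real n ^ n / fact n \<le> exp (real n)"
    using sum_le_suminf[OF summable_exp[of "real n"], of "{n}"]
    by (simp add: exp_def divide_inverse mult.commute)
  also have "exp (real n) = exp 1 ^ n" by (simp add: exp_of_nat_mult[symmetric])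
  also have "\<dots> \<le> 3 ^ n" using exp_le by (intro power_mono) auto
  finally show ?thesis by (simp add: field_simps)
qed

section \<open>Failure probability of one fibre and the union bound over all fibres\<close>

lemma card_fibre_cube:
  assumes X: "X \<subseteq> {..<k}" and k: "k \<le> d"
  shows "card (fibre k (cube d) X) = 2 ^ (d - k)"
proof -
  have bij: "bij_betw ones (cube d) (Pow {..<d})" using bij_betw_cube[of d] by (simp add: ones_def[abs_def])
  have "card (fibre k (cube d) X) = card (ones ` fibre k (cube d) X)"
    using bij by (intro card_image[symmetric]) (auto simp: bij_betw_def fibre_def intro: inj_on_subset)
  also have "ones ` fibre k (cube d) X = {A \<in> ones ` cube d. A \<inter> {..<k} = X}"
    by (auto simp: fibre_def)
  also have "ones ` cube d = Pow {..<d}" using bij by (simp add: bij_betw_def)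
  also have "{A \<in> Pow {..<d}. A \<inter> {..<k} = X} = (\<union>) X ` Pow {k..<d}" (is "?L = ?R")
  proof
    show "?L \<subseteq> ?R"
    proof
      fix A assume "A \<in> ?L"
      then show "A \<in> ?R" by (intro image_eqI[of _ _ "A \<inter> {k..<d}"]) auto
    qed
    show "?R \<subseteq> ?L" using X k by fastforce
  qed
  also have "card \<dots> = card (Pow {k..<d})"
  proof (rule card_image, rule inj_onI)
    fix A B assume AB: "A \<in> Pow {k..<d}" "B \<in> Pow {k..<d}" "X \<union> A = X \<union> B"
    have "A = (X \<union> A) \<inter> {k..<d}" "B = (X \<union> B) \<inter> {k..<d}" using AB(1,2) X by fastforce+
    then show "A = B" using AB(3) by simp
  qed
  also have "\<dots> = 2 ^ (d - k)" by (simp add: card_Pow)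
  finally show ?thesis .
qed

definition expanding :: "nat \<Rightarrow> (nat \<Rightarrow>\<^sub>0 real) set \<Rightarrow> bool" where
  "expanding d P \<longleftrightarrow> ereal (1/576 * real d powr (-3/2)) \<le> polytope_expansion P"

text \<open>The factor 2^d bounds the number of fibres; the two summands bound the probabilities
  that a given fibre is empty or has at least 12d points.\<close>

definition failure_bound :: "nat \<Rightarrow> real" where
  "failure_bound d = 2 ^ d * (exp (- real d) + (1/2) ^ (12 * d))"

lemma failure_bound_tendsto: "failure_bound \<longlonglongrightarrow> 0"
proof -
  have eq: "failure_bound d = (2 / exp 1) ^ d + (2 * (1/2) ^ 12) ^ d" for d
  proof -
    have "exp (- real d) = (1 / exp 1) ^ d"
      by (simp add: exp_minus exp_of_nat_mult[symmetric] power_divide inverse_eq_divide)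
    then show ?thesis
      unfolding failure_bound_def power_mult distrib_left power_mult_distrib
      by (simp add: power_divide)
  qed
  have "(2::real) < exp 1" using exp_lower_Taylor_quadratic[of "1::real"] by simp
  then have "(\<lambda>d. (2 / exp 1 :: real) ^ d) \<longlonglongrightarrow> 0" by (intro LIMSEQ_power_zero) auto
  moreover have "(\<lambda>d. (2 * (1/2) ^ 12 :: real) ^ d) \<longlonglongrightarrow> 0"
    by (intro LIMSEQ_power_zero) (simp add: power_divide)
  ultimately show ?thesis unfolding eq[abs_def] by (rule tendsto_add_zero)
qed

lemma card_bad_fibre_le:
  assumes X: "X \<subseteq> {..<k}" and k: "k \<le> d" and m: "12 * d \<le> m" "m \<le> 2 ^ d" and d: "0 < d"
    and lo: "d * 2 ^ k \<le> m" and hi: "m \<le> 2 * d * 2 ^ k"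
  shows "real (card {U. U \<subseteq> cube d \<and> card U = m \<and> (fibre k U X = {} \<or> 12 * d \<le> card (fibre k U X))})
    \<le> real (2 ^ d choose m) * (exp (- real d) + (1/2) ^ (12 * d))"
proof -
  define F where "F = fibre k (cube d) X"
  have F: "F \<subseteq> cube d" by (auto simp: F_def fibre_def)
  have ne: "cube d \<noteq> {}" using card_cube[of d] by force
  have frac: "real (card F) / real (card (cube d)) = 1 / 2 ^ k"
  proof -
    have "(2::real) ^ d = 2 ^ (d - k) * 2 ^ k" using k by (simp add: power_add[symmetric])
    then show ?thesis by (simp add: F_def card_fibre_cube[OF X k] card_cube)
  qed
  have fib: "fibre k U X = U \<inter> F" if "U \<subseteq> cube d" for U
    using that by (auto simp: F_def fibre_def)
  have "{U. U \<subseteq> cube d \<and> card U = m \<and> (fibre k U X = {} \<or> 12 * d \<le> card (fibre k U X))}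
      = {U. U \<subseteq> cube d \<and> card U = m \<and> U \<inter> F = {}} \<union> {U. U \<subseteq> cube d \<and> card U = m \<and> 12 * d \<le> card (U \<inter> F)}"
    using fib by auto
  then have "card {U. U \<subseteq> cube d \<and> card U = m \<and> (fibre k U X = {} \<or> 12 * d \<le> card (fibre k U X))}
      \<le> card {U. U \<subseteq> cube d \<and> card U = m \<and> U \<inter> F = {}}
        + card {U. U \<subseteq> cube d \<and> card U = m \<and> 12 * d \<le> card (U \<inter> F)}"
    by (simp add: card_Un_le)
  then have "real (card {U. U \<subseteq> cube d \<and> card U = m \<and> (fibre k U X = {} \<or> 12 * d \<le> card (fibre k U X))})
      \<le> real (card {U. U \<subseteq> cube d \<and> card U = m \<and> U \<inter> F = {}})
        + real (card {U. U \<subseteq> cube d \<and> card U = m \<and> 12 * d \<le> card (U \<inter> F)})"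
    by linarith
  also have "\<dots> \<le> real (2 ^ d choose m) * exp (- real d) + real (2 ^ d choose m) * (1/2) ^ (12 * d)"
  proof (rule add_mono)
    have "(1 - 1 / 2 ^ k :: real) ^ m \<le> exp (- 1 / 2 ^ k) ^ m"
      using exp_ge_add_one_self[of "- 1 / 2 ^ k :: real"] by (intro power_mono) auto
    also have "\<dots> = exp (- (real m / 2 ^ k))" by (simp add: exp_of_nat_mult[symmetric])
    also have "\<dots> \<le> exp (- real d)"
    proof -
      have "real (d * 2 ^ k) \<le> real m" using lo by (rule of_nat_mono)
      then show ?thesis by (simp add: field_simps)
    qed
    finally have "real (2 ^ d choose m) * (1 - 1 / 2 ^ k) ^ m \<le> real (2 ^ d choose m) * exp (- real d)"
      by (intro mult_left_mono) auto
    then show "real (card {U. U \<subseteq> cube d \<and> card U = m \<and> U \<inter> F = {}}) \<le> real (2 ^ d choose m) * exp (- real d)"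
      using card_subsets_disjoint_le[OF finite_cube ne F, of m] by (simp add: frac) (simp add: card_cube)
  next
    define t where "t = 12 * d"
    have "real m \<le> real (2 * d * 2 ^ k)" using hi by (rule of_nat_mono)
    then have "real (card F) * m / card (cube d) \<le> 2 * d"
      using frac by (simp add: field_simps)
    then have "(real (card F) * m / card (cube d)) ^ t \<le> (2 * real d) ^ t"
      by (intro power_mono) auto
    \<comment> \<open>The origin of 12 = 2 * 3 * 2: the mean is at most 2d, the factorial estimate
      costs 3, and a factor 2 is left for the decay.\<close>
    also have "\<dots> = (1/2) ^ t * (real t ^ t / 3 ^ t)"
      unfolding power_divide[symmetric] power_mult_distrib[symmetric] by (simp add: t_def)
    also have "\<dots> \<le> (1/2) ^ t * fact t"
      using power_le_3_power_mult_fact[of t] by (intro mult_left_mono) (auto simp: field_simps)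
    finally have "(real (card F) * m / card (cube d)) ^ t / fact t \<le> (1/2) ^ t"
      by (simp add: divide_le_eq)
    then have "real (2 ^ d choose m) * ((real (card F) * m / card (cube d)) ^ t / fact t)
        \<le> real (2 ^ d choose m) * (1/2) ^ t"
      by (intro mult_left_mono) auto
    moreover have "real (card {U. U \<subseteq> cube d \<and> card U = m \<and> t \<le> card (U \<inter> F)})
        \<le> real (2 ^ d choose m) * ((real (card F) * m / card (cube d)) ^ t / fact t)"
      using card_subsets_meeting_le[OF finite_cube ne F, of t m] m by (simp add: card_cube t_def)
    ultimately show "real (card {U. U \<subseteq> cube d \<and> card U = m \<and> 12 * d \<le> card (U \<inter> F)})
        \<le> real (2 ^ d choose m) * (1/2) ^ (12 * d)"
      unfolding t_def[symmetric] by linarith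
  qed
  finally show ?thesis by (simp add: distrib_left)
qed

lemma scale_exists:
  fixes d m :: nat
  assumes "0 < d" "d \<le> m"
  obtains k where "d * 2 ^ k \<le> m" "m \<le> 2 * d * 2 ^ k"
proof -
  have "m < d * 2 ^ m"
    using assms less_exp[of m] by (metis Suc_leI le_less_trans less_le_trans mult_le_mono1 nat_mult_1 One_nat_def)
  then obtain j where j: "m < d * 2 ^ j" "\<And>i. i < j \<Longrightarrow> \<not> m < d * 2 ^ i"
    using exists_least_iff[of "\<lambda>j. m < d * 2 ^ j"] by blast
  have "j \<noteq> 0" using j assms by (intro notI) simp
  then obtain k where "j = Suc k" using not0_implies_Suc by blast
  then show ?thesis using j(1) j(2)[of k] by (intro that[of k]) auto
qed

lemma card_expanding_ge:
  assumes m: "m \<le> 2 ^ d"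
  shows "(1 - failure_bound d) * real (2 ^ d choose m)
    \<le> real (card {U. U \<subseteq> cube d \<and> card U = m \<and> expanding d (convex hull U)})"
proof (cases "d = 0")
  \<comment> \<open>Here \<open>failure_bound\<close> is 2, so the left side is not
    positive.\<close>
  case True
  then show ?thesis by (simp add: failure_bound_def)
next
  case False
  then have d: "0 < d" by simp
  have fin: "finite {U. U \<subseteq> cube d \<and> card U = m}" by (rule finite_cube_subsets)
  have total: "card {U. U \<subseteq> cube d \<and> card U = m} = 2 ^ d choose m"
    by (simp add: n_subsets finite_cube card_cube)
  show ?thesis
  proof (cases "m \<le> 12 * d")
    case True
    then have "expanding d (convex hull U)" if "U \<subseteq> cube d" "card U = m" for U
      unfolding expanding_def using that d by (intro polytope_expansion_ge_of_fibres) auto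
    then have "{U. U \<subseteq> cube d \<and> card U = m \<and> expanding d (convex hull U)} = {U. U \<subseteq> cube d \<and> card U = m}"
      by auto
    moreover have "(1 - failure_bound d) * real (2 ^ d choose m) \<le> 1 * real (2 ^ d choose m)"
      by (intro mult_right_mono) (auto simp: failure_bound_def)
    ultimately show ?thesis using total by simp
  next
    case False
    then obtain k where k: "d * 2 ^ k \<le> m" "m \<le> 2 * d * 2 ^ k"
      using scale_exists[of d m] d by auto
    have "2 ^ k \<le> d * 2 ^ k" using d by simp
    then have "(2::nat) ^ k \<le> 2 ^ d" using k(1) m by linarith
    then have kd: "k \<le> d" by simp
    define Bad where "Bad X = {U. U \<subseteq> cube d \<and> card U = m \<and> (fibre k U X = {} \<or> 12 * d \<le> card (fibre k U X))}" for X
    define G where "G = {U. U \<subseteq> cube d \<and> card U = m \<and> expanding d (convex hull U)}"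
    have "{U. U \<subseteq> cube d \<and> card U = m} \<subseteq> G \<union> (\<Union>X\<in>Pow {..<k}. Bad X)"
    proof
      fix U assume U: "U \<in> {U. U \<subseteq> cube d \<and> card U = m}"
      show "U \<in> G \<union> (\<Union>X\<in>Pow {..<k}. Bad X)"
      proof (cases "U \<in> (\<Union>X\<in>Pow {..<k}. Bad X)")
        case False
        then have *: "\<forall>X\<subseteq>{..<k}. fibre k U X \<noteq> {} \<and> card (fibre k U X) \<le> 12 * d"
        proof (intro allI impI)
          fix X assume "X \<subseteq> {..<k}"
          then have "U \<notin> Bad X" using False by blast
          then show "fibre k U X \<noteq> {} \<and> card (fibre k U X) \<le> 12 * d"
            using U unfolding Bad_def by auto
        qed
        have "expanding d (convex hull U)"
          unfolding expanding_def
          by (rule polytope_expansion_ge_of_fibres) (use U d kd k * in auto)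
        then show ?thesis using U by (auto simp: G_def)
      qed auto
    qed
    moreover have "finite G" using fin by (rule rev_finite_subset) (auto simp: G_def)
    moreover have "finite (\<Union>X\<in>Pow {..<k}. Bad X)"
      using fin by (rule rev_finite_subset) (auto simp: Bad_def)
    ultimately have "2 ^ d choose m \<le> card (G \<union> (\<Union>X\<in>Pow {..<k}. Bad X))"
      unfolding total[symmetric] by (intro card_mono) auto
    also have "\<dots> \<le> card G + card (\<Union>X\<in>Pow {..<k}. Bad X)" by (rule card_Un_le)
    also have "\<dots> \<le> card G + (\<Sum>X\<in>Pow {..<k}. card (Bad X))"
      by (intro add_left_mono card_UN_le) simp
    finally have "real (2 ^ d choose m) \<le> real (card G + (\<Sum>X\<in>Pow {..<k}. card (Bad X)))"
      by (rule of_nat_mono)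
    then have 1: "real (2 ^ d choose m) \<le> real (card G) + (\<Sum>X\<in>Pow {..<k}. real (card (Bad X)))"
      by simp
    have "(\<Sum>X\<in>Pow {..<k}. real (card (Bad X)))
        \<le> of_nat (card (Pow {..<k})) * (real (2 ^ d choose m) * (exp (- real d) + (1/2) ^ (12 * d)))"
      unfolding Bad_def using kd False m d k
      by (intro sum_bounded_above card_bad_fibre_le) auto
    also have "\<dots> = 2 ^ k * (real (2 ^ d choose m) * (exp (- real d) + (1/2) ^ (12 * d)))"
      by (simp add: card_Pow)
    also have "\<dots> \<le> 2 ^ d * (real (2 ^ d choose m) * (exp (- real d) + (1/2) ^ (12 * d)))"
      using kd by (intro mult_right_mono) auto
    also have "\<dots> = failure_bound d * real (2 ^ d choose m)"
      by (simp add: failure_bound_def)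
    finally show ?thesis using 1 by (simp add: G_def left_diff_distrib)
  qed
qed

section \<open>Exchangeable random subsets\<close>

text \<open>Conditioning on the size, written as a sum over the levels of constant
  \<open>card\<close>. No conditional law is formed, so levels of probability zero need no separate
  treatment.\<close>

lemma prob_ge_of_exchangeable:
  fixes Q :: "'a set pmf"
  assumes V: "finite V" and Q: "set_pmf Q \<subseteq> Pow V"
    and exch: "\<And>A B. A \<subseteq> V \<Longrightarrow> B \<subseteq> V \<Longrightarrow> card A = card B \<Longrightarrow> pmf Q A = pmf Q B"
    and ge: "\<And>m. m \<le> card V \<Longrightarrow> c * real (card V choose m) \<le> real (card {U. U \<subseteq> V \<and> card U = m \<and> G U})"
  shows "c \<le> measure_pmf.prob Q {U. G U}"
proof -
  have level: "c * (\<Sum>A\<in>{A \<in> Pow V. card A = m}. pmf Q A) \<le> (\<Sum>A\<in>{A \<in> {A \<in> Pow V. G A}. card A = m}. pmf Q A)"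
    if m: "m \<le> card V" for m
  proof -
    obtain A0 where A0: "A0 \<subseteq> V" "card A0 = m" using obtain_subset_with_card_n[OF m] by blast
    have "(\<Sum>A\<in>{A \<in> Pow V. card A = m}. pmf Q A) = (\<Sum>A\<in>{A \<in> Pow V. card A = m}. pmf Q A0)"
      using A0 by (intro sum.cong refl exch) auto
    also have "\<dots> = real (card V choose m) * pmf Q A0"
      using V by (simp add: n_subsets Pow_def)
    finally have 1: "(\<Sum>A\<in>{A \<in> Pow V. card A = m}. pmf Q A) = real (card V choose m) * pmf Q A0" .
    have "(\<Sum>A\<in>{A \<in> {A \<in> Pow V. G A}. card A = m}. pmf Q A)
        = (\<Sum>A\<in>{U. U \<subseteq> V \<and> card U = m \<and> G U}. pmf Q A0)"
      using A0 by (intro sum.cong exch) auto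
    also have "\<dots> = real (card {U. U \<subseteq> V \<and> card U = m \<and> G U}) * pmf Q A0" by simp
    finally show ?thesis
      unfolding 1 using mult_right_mono[OF ge[OF m], of "pmf Q A0"] by (simp add: mult.assoc)
  qed
  have fin: "finite (Pow V)" "finite {A \<in> Pow V. G A}" using V by auto
  have img: "card ` Pow V \<subseteq> {..card V}" "card ` {A \<in> Pow V. G A} \<subseteq> {..card V}"
    using V card_mono by fastforce+
  have "c = c * (\<Sum>A\<in>Pow V. pmf Q A)" using sum_pmf_eq_1[OF fin(1) Q] by simp
  also have "\<dots> = (\<Sum>m\<le>card V. c * (\<Sum>A\<in>{A \<in> Pow V. card A = m}. pmf Q A))"
    unfolding sum.group[OF fin(1) finite_atMost img(1), of "pmf Q", symmetric] sum_distrib_left ..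
  also have "\<dots> \<le> (\<Sum>m\<le>card V. \<Sum>A\<in>{A \<in> {A \<in> Pow V. G A}. card A = m}. pmf Q A)"
    using level by (intro sum_mono) auto
  also have "\<dots> = (\<Sum>A\<in>{A \<in> Pow V. G A}. pmf Q A)"
    by (rule sum.group[OF fin(2) finite_atMost img(2)])
  also have "\<dots> = measure_pmf.prob Q {A \<in> Pow V. G A}"
    using fin(2) by (simp add: measure_measure_pmf_finite)
  also have "\<dots> \<le> measure_pmf.prob Q {U. G U}"
    by (intro measure_pmf.finite_measure_mono) auto
  finally show ?thesis .
qed

text \<open>The permutation of \<open>V\<close> is extended by the identity, so that taking images
  under it is injective on all sets of the type.\<close>

lemma bij_mapping_subset_exists:
  assumes V: "finite V" and "A \<subseteq> V" "B \<subseteq> V" "card A = card B"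
  obtains \<sigma> where "bij \<sigma>" "\<sigma> ` V = V" "\<sigma> ` A = B"
proof -
  have fin: "finite A" "finite B" using assms finite_subset by blast+
  obtain f where f: "bij_betw f A B" using finite_same_card_bij[OF fin] assms by blast
  have "card (V - A) = card (V - B)" using assms fin by (simp add: card_Diff_subset)
  then obtain g where g: "bij_betw g (V - A) (V - B)" using finite_same_card_bij[of "V - A" "V - B"] V by blast
  define h where "h x = (if x \<in> A then f x else g x)" for x
  define \<sigma> where "\<sigma> x = (if x \<in> V then h x else x)" for x
  have hA: "bij_betw h A B" using f by (subst bij_betw_cong[of _ _ f]) (auto simp: h_def)
  moreover have "bij_betw h (V - A) (V - B)" using g by (subst bij_betw_cong[of _ _ g]) (auto simp: h_def)
  ultimately have "bij_betw h (A \<union> (V - A)) (B \<union> (V - B))" by (rule bij_betw_combine) auto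
  moreover have "A \<union> (V - A) = V" "B \<union> (V - B) = V" using assms by auto
  ultimately have "bij_betw h V V" by simp
  then have sV: "bij_betw \<sigma> V V" by (subst bij_betw_cong[of _ _ h]) (auto simp: \<sigma>_def)
  moreover have "bij_betw \<sigma> (- V) (- V)" by (subst bij_betw_cong[of _ _ id]) (auto simp: \<sigma>_def)
  ultimately have "bij_betw \<sigma> (V \<union> - V) (V \<union> - V)" by (rule bij_betw_combine) auto
  then have "bij \<sigma>" by simp
  moreover have "\<sigma> ` A = h ` A" using assms by (intro image_cong) (auto simp: \<sigma>_def)
  then have "\<sigma> ` A = B" using hA by (simp add: bij_betw_def)
  ultimately show ?thesis using sV by (intro that) (auto simp: bij_betw_def)
qed

lemma map_replicate_pmf: "map_pmf (map f) (replicate_pmf n p) = replicate_pmf n (map_pmf f p)"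
proof (induction n)
  case (Suc n)
  show ?case by (simp add: map_bind_pmf bind_map_pmf Suc[symmetric])
qed simp

text \<open>Permuting \<open>V\<close> preserves the law of each sample, hence the law of the set of
  samples. This symmetry avoids counting surjections.\<close>

lemma pmf_set_replicate_exchangeable:
  assumes V: "finite V" "V \<noteq> {}" and A: "A \<subseteq> V" and B: "B \<subseteq> V" and card: "card A = card B"
  shows "pmf (map_pmf set (replicate_pmf n (pmf_of_set V))) A
    = pmf (map_pmf set (replicate_pmf n (pmf_of_set V))) B"
proof -
  obtain \<sigma> where s: "bij \<sigma>" "\<sigma> ` V = V" "\<sigma> ` A = B"
    using bij_mapping_subset_exists[OF V(1) A B card] by blast
  have inj: "inj \<sigma>" using s(1) by (rule bij_is_inj)
  have "map_pmf \<sigma> (pmf_of_set V) = pmf_of_set V"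
    using map_pmf_of_set_inj[of \<sigma> V] V s(2) inj by (simp add: inj_on_subset)
  then have "map_pmf set (replicate_pmf n (pmf_of_set V))
      = map_pmf set (map_pmf (map \<sigma>) (replicate_pmf n (pmf_of_set V)))"
    by (simp add: map_replicate_pmf)
  also have "\<dots> = map_pmf ((`) \<sigma>) (map_pmf set (replicate_pmf n (pmf_of_set V)))"
    by (simp add: map_pmf_comp)
  finally have "pmf (map_pmf set (replicate_pmf n (pmf_of_set V))) B
      = pmf (map_pmf ((`) \<sigma>) (map_pmf set (replicate_pmf n (pmf_of_set V)))) (\<sigma> ` A)"
    using s(3) by simp
  also have "\<dots> = pmf (map_pmf set (replicate_pmf n (pmf_of_set V))) A"
    using inj by (intro pmf_map_inj') (simp add: inj_image_eq_iff inj_def)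
  finally show ?thesis ..
qed

lemma pmf_binomial_subset:
  assumes V: "finite V" and A: "A \<subseteq> V" and p: "0 \<le> p" "p \<le> 1"
  shows "pmf (map_pmf (\<lambda>X. {v \<in> V. X v}) (Pi_pmf V False (\<lambda>_. bernoulli_pmf p))) A
    = p ^ card A * (1 - p) ^ (card V - card A)"
proof -
  have "(\<lambda>X. {v \<in> V. X v}) -` {A} = Pi V (\<lambda>v. {v \<in> A})" using A by (auto simp: Pi_def)
  then have "pmf (map_pmf (\<lambda>X. {v \<in> V. X v}) (Pi_pmf V False (\<lambda>_. bernoulli_pmf p))) A
      = (\<Prod>v\<in>V. pmf (bernoulli_pmf p) (v \<in> A))"
    by (simp add: pmf_map measure_Pi_pmf_Pi[OF V] measure_pmf_single)
  also have "\<dots> = (\<Prod>v\<in>V. if v \<in> A then p else 1 - p)"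
    using p by (intro prod.cong) auto
  also have "\<dots> = p ^ card A * (1 - p) ^ card (V - A)"
    using V A by (simp add: prod.If_cases Int_absorb1 Diff_eq)
  also have "card (V - A) = card V - card A" using V A finite_subset by (intro card_Diff_subset) auto
  finally show ?thesis .
qed

section \<open>Reduction of the three models to exchangeability\<close>

lemma prob_expanding_ge:
  assumes "set_pmf Q \<subseteq> Pow (cube d)"
    and "\<And>A B. A \<subseteq> cube d \<Longrightarrow> B \<subseteq> cube d \<Longrightarrow> card A = card B \<Longrightarrow> pmf Q A = pmf Q B"
  shows "1 - failure_bound d \<le> measure_pmf.prob (map_pmf (\<lambda>U. convex hull U) Q)
    {P. polytope_expansion P \<ge> ereal (1/576 * real d powr (-3/2))}"
proof -
  have "1 - failure_bound d \<le> measure_pmf.prob Q {U. expanding d (convex hull U)}"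
    by (rule prob_ge_of_exchangeable[OF finite_cube assms]) (auto simp: card_cube intro: card_expanding_ge)
  then show ?thesis by (simp add: vimage_def expanding_def)
qed

theorem theorem3p2:
  shows "\<exists>(C::real) (f::nat \<Rightarrow> real). C > 0 \<and> f \<longlonglongrightarrow> 1 \<and>
    (\<forall>d::nat.
      (\<forall>n::nat. measure_pmf.prob (balls_into_bins_polytope d n)
          {P. polytope_expansion P \<ge> ereal (C * real d powr (-3/2))} \<ge> f d) \<and>
      (\<forall>p::real. 0 < p \<and> p < 1 \<longrightarrow> measure_pmf.prob (binomial_polytope d p)
          {P. polytope_expansion P \<ge> ereal (C * real d powr (-3/2))} \<ge> f d) \<and>
      (\<forall>n::nat. 1 \<le> n \<and> n \<le> 2 ^ d \<longrightarrow> measure_pmf.prob (uniform_polytope d n)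
          {P. polytope_expansion P \<ge> ereal (C * real d powr (-3/2))} \<ge> f d))"
proof (intro exI[of _ "1/576"] exI[of _ "\<lambda>d. 1 - failure_bound d"] conjI allI impI)
  show "(\<lambda>d. 1 - failure_bound d) \<longlonglongrightarrow> 1"
    using tendsto_diff[OF tendsto_const[of 1] failure_bound_tendsto] by simp
  fix d n :: nat
  have ne: "cube d \<noteq> {}" using card_cube[of d] by force
  have eq: "balls_into_bins_polytope d n
      = map_pmf (\<lambda>U. convex hull U) (map_pmf set (replicate_pmf n (pmf_of_set (cube d))))"
    by (simp add: balls_into_bins_polytope_def map_pmf_comp)
  have "set_pmf (map_pmf set (replicate_pmf n (pmf_of_set (cube d)))) \<subseteq> Pow (cube d)"
    using ne by (auto simp: set_replicate_pmf set_pmf_of_set[OF ne finite_cube])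
  then show "1 - failure_bound d \<le> measure_pmf.prob (balls_into_bins_polytope d n)
      {P. polytope_expansion P \<ge> ereal (1/576 * real d powr (-3/2))}"
    unfolding eq by (rule prob_expanding_ge[OF _ pmf_set_replicate_exchangeable[OF finite_cube ne]])
next
  fix d :: nat and p :: real
  assume p: "0 < p \<and> p < 1"
  let ?Q = "map_pmf (\<lambda>X. {v \<in> cube d. X v}) (Pi_pmf (cube d) False (\<lambda>_. bernoulli_pmf p))"
  have eq: "binomial_polytope d p = map_pmf (\<lambda>U. convex hull U) ?Q"
    by (simp add: binomial_polytope_def map_pmf_comp)
  have "set_pmf ?Q \<subseteq> Pow (cube d)" by auto
  moreover have "pmf ?Q A = pmf ?Q B" if "A \<subseteq> cube d" "B \<subseteq> cube d" "card A = card B" for A B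
    using that p by (simp add: pmf_binomial_subset[OF finite_cube])
  ultimately show "1 - failure_bound d \<le> measure_pmf.prob (binomial_polytope d p)
      {P. polytope_expansion P \<ge> ereal (1/576 * real d powr (-3/2))}"
    unfolding eq by (rule prob_expanding_ge)
next
  fix d n :: nat
  assume n: "1 \<le> n \<and> n \<le> 2 ^ d"
  let ?Q = "pmf_of_set {U. U \<subseteq> cube d \<and> card U = n}"
  note ne = cube_subsets_nonempty[of n d] and fin = finite_cube_subsets[of d n]
  have "set_pmf ?Q \<subseteq> Pow (cube d)" using n by (auto simp: set_pmf_of_set[OF ne fin])
  moreover have "pmf ?Q A = pmf ?Q B" if "A \<subseteq> cube d" "B \<subseteq> cube d" "card A = card B" for A B
    using that n by (simp add: pmf_of_set[OF ne fin] indicator_def)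
  ultimately show "1 - failure_bound d \<le> measure_pmf.prob (uniform_polytope d n)
      {P. polytope_expansion P \<ge> ereal (1/576 * real d powr (-3/2))}"
    unfolding uniform_polytope_def by (rule prob_expanding_ge)
qed simp

end
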